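(* There exists $n_0$ such that for every integer $n\geq n_0$ there is a finite connected graph $G$ with $\operatorname{rl_p}(G)=n$ and $\operatorname{rl_s}(G)>2n-7.2\log n$, where $\log$ denotes the natural logarithm.
   Context: Graphs are simple and undirected; $d(\cdot,\cdot)$ denotes graph distance. The $k$-probe Robber Locating game on a graph $G$ (known to both players): a robber occupies a vertex of $G$, initially arbitrary and unknown to the cop. Cop and robber alternate turns, the cop first. At her turn the cop chooses a list $u_1,\ldots,u_k$ of vertices (all specified before any answer is received) and is then told the distances $d(v,u_1),\ldots,d(v,u_k)$, where $v$ is the robber's current location. If from this and all previous information she can deduce $v$, she wins. At his turn the robber may stay where he is or move to an adjacent vertex. $G$ is $k$-locatable if the cop has a deterministic strategy (each list of probes may depend on previous answers) which wins after finitely many turns against every possible starting vertex and sequence of moves of the robber. $G$ is locatable if it is $1$-locatable. For a positive integer $m$, $G^{1/m}$ is the graph obtained from $G$ by replacing each edge by a path of length $m$ (with $m-1$ new internal vertices for each edge). $\operatorname{rl_p}(G)$ is the minimum $k$ such that $G$ is $k$-locatable; $\operatorname{rl_s}(G)$ is the smallest positive integer $s$ such that $G^{1/m}$ is locatable for all integers $m\geq s$. *)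

theory Defs
  imports Complex_Main "Graph_Theory.Graph_Theory"
begin

definition graph_dist :: "'a pair_pre_digraph \<Rightarrow> 'a \<Rightarrow> 'a \<Rightarrow> ereal" where
  "graph_dist G u v = wf_digraph.\<mu> (with_proj G) (\<lambda>_. 1) u v"

text \<open>\<open>r t\<close> is the position of the robber when the cop makes her probes for the
  \<open>(t + 1)\<close>-st time.\<close>

definition robber_walk :: "'a pair_pre_digraph \<Rightarrow> (nat \<Rightarrow> 'a) \<Rightarrow> bool" where
  "robber_walk G r \<longleftrightarrow>
     (\<forall>t. r t \<in> pverts G \<and> (r (Suc t) = r t \<or> (r t, r (Suc t)) \<in> parcs G))"

text \<open>A history lists, turn by turn, the answers received so far. A deterministic strategy
  maps it to the next list of probes; earlier probes are themselves determined by the history.\<close>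

type_synonym history = "ereal list list"

type_synonym 'a strategy = "history \<Rightarrow> 'a list"

definition probe_strategy :: "'a pair_pre_digraph \<Rightarrow> nat \<Rightarrow> 'a strategy \<Rightarrow> bool" where
  "probe_strategy G k \<sigma> \<longleftrightarrow> (\<forall>h. length (\<sigma> h) = k \<and> set (\<sigma> h) \<subseteq> pverts G)"

primrec answers :: "'a pair_pre_digraph \<Rightarrow> 'a strategy \<Rightarrow> (nat \<Rightarrow> 'a) \<Rightarrow> nat \<Rightarrow> history" where
  "answers G \<sigma> r 0 = []"
| "answers G \<sigma> r (Suc t) =
     answers G \<sigma> r t @ [map (graph_dist G (r t)) (\<sigma> (answers G \<sigma> r t))]"

text \<open>The cop can deduce the position \<open>r t\<close> iff every walk of the robber that is consistent
  with all answers up to and including those to the probes at time \<open>t\<close> has that position at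
  time \<open>t\<close>. That the game has not ended before is no additional information, since whether
  the cop has won at an earlier turn depends only on the answers up to that turn.\<close>

definition deduces :: "'a pair_pre_digraph \<Rightarrow> 'a strategy \<Rightarrow> (nat \<Rightarrow> 'a) \<Rightarrow> nat \<Rightarrow> bool" where
  "deduces G \<sigma> r t \<longleftrightarrow>
     (\<forall>r'. robber_walk G r' \<and> answers G \<sigma> r' (Suc t) = answers G \<sigma> r (Suc t) \<longrightarrow> r' t = r t)"

definition locatable_with :: "nat \<Rightarrow> 'a pair_pre_digraph \<Rightarrow> bool" where
  "locatable_with k G \<longleftrightarrow>
     (\<exists>\<sigma>. probe_strategy G k \<sigma> \<and> (\<forall>r. robber_walk G r \<longrightarrow> (\<exists>t. deduces G \<sigma> r t)))"

abbreviation locatable :: "'a pair_pre_digraph \<Rightarrow> bool" where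
  "locatable \<equiv> locatable_with 1"

text \<open>In \<open>G\<^sup>1\<^sup>/\<^sup>m\<close>, \<open>Inner u v i\<close> with \<open>u < v\<close> and \<open>0 < i < m\<close> is the vertex at distance \<open>i\<close> from \<open>u\<close> on the
  path of length \<open>m\<close> that replaces the edge \<open>uv\<close>. The linear order on the vertices only
  serves to pick one of the two orientations of each edge.\<close>

datatype 'a subdiv_vertex = Orig 'a | Inner 'a 'a nat

definition path_vertex :: "nat \<Rightarrow> 'a \<Rightarrow> 'a \<Rightarrow> nat \<Rightarrow> 'a subdiv_vertex" where
  "path_vertex m u v i = (if i = 0 then Orig u else if i = m then Orig v else Inner u v i)"

definition equal_subdivision ::
  "'a::linorder pair_pre_digraph \<Rightarrow> nat \<Rightarrow> 'a subdiv_vertex pair_pre_digraph" where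
  "equal_subdivision G m =
     (let P = {(path_vertex m u v i, path_vertex m u v (Suc i)) | u v i.
                 (u, v) \<in> parcs G \<and> u < v \<and> i < m}
      in \<lparr> pverts = Orig ` pverts G \<union>
                    {Inner u v i | u v i. (u, v) \<in> parcs G \<and> u < v \<and> 0 < i \<and> i < m},
           parcs = P \<union> P\<inverse> \<rparr>)"

lemma pair_graph_equal_subdivision:
  assumes "pair_graph G" "m > 0"
  shows "pair_graph (equal_subdivision G m)"
proof -
  interpret pair_graph G by fact
  let ?S = "equal_subdivision G m"
  let ?f = "\<lambda>((u, v), i). Inner u v i"
  let ?g = "\<lambda>((u, v), i). (path_vertex m u v i, path_vertex m u v (Suc i))"
  have V: "pverts ?S \<subseteq> Orig ` pverts G \<union> ?f ` (parcs G \<times> {..<m})"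
    by (force simp: equal_subdivision_def Let_def)
  have A: "parcs ?S \<subseteq> ?g ` (parcs G \<times> {..<m}) \<union> (?g ` (parcs G \<times> {..<m}))\<inverse>"
    by (force simp: equal_subdivision_def Let_def)
  have pv: "path_vertex m u v i \<in> pverts ?S" if "(u, v) \<in> parcs G" "u < v" "i \<le> m" for u v i
    using that by (fastforce simp: equal_subdivision_def Let_def path_vertex_def in_arcsD1 in_arcsD2)
  have ne: "path_vertex m u v i \<noteq> path_vertex m u v (Suc i)" if "u < v" "i < m" for u v :: 'a and i
    using that by (auto simp: path_vertex_def)
  have wf: "fst e \<in> pverts ?S \<and> snd e \<in> pverts ?S \<and> fst e \<noteq> snd e" if e: "e \<in> parcs ?S" for e
  proof -
    obtain u v i where uv: "(u, v) \<in> parcs G" "u < v" "i < m"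
      and "e = (path_vertex m u v i, path_vertex m u v (Suc i)) \<or>
           e = (path_vertex m u v (Suc i), path_vertex m u v i)"
      using e by (auto simp: equal_subdivision_def Let_def)
    then show ?thesis
      using pv[of u v i] pv[of u v "Suc i"] ne[of u v i] by auto
  qed
  show ?thesis
  proof
    show "finite (pverts ?S)"
      by (rule finite_subset[OF V]) simp
    show "finite (parcs ?S)"
      by (rule finite_subset[OF A]) (simp only: finite_Un finite_converse, simp)
    show "symmetric ?S"
      by (auto simp: symmetric_def sym_def arcs_ends_def arc_to_ends_def equal_subdivision_def
          Let_def)
  qed (use wf in auto)
qed

definition rl_p :: "'a pair_pre_digraph \<Rightarrow> nat" where
  "rl_p G = (LEAST k. locatable_with k G)"

definition rl_s :: "'a::linorder pair_pre_digraph \<Rightarrow> nat" where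
  "rl_s G = (LEAST s. 0 < s \<and> (\<forall>m\<ge>s. locatable (equal_subdivision G m)))"

end

theory Submission
  imports Defs "HOL-Library.Nat_Bijection"
begin

text \<open>
  Let \<open>U\<close> be a set of \<open>n\<close> vertices, no two of them adjacent. Add a clique \<open>W\<close> with one vertex for each
  subset \<open>A\<close> of \<open>U\<close> of size at most \<open>c\<close>, and join the vertex of \<open>A\<close> to the elements of \<open>U\<close> outside \<open>A\<close>.
  Here \<open>c\<close> is about \<open>log\<^sub>2 n\<close>. All distances are at most 2.

  The number of probes is \<open>n\<close>. Probing all of \<open>U\<close> locates every vertex, since \<open>A\<close> is the set of
  elements of \<open>U\<close> at distance 2 from its vertex. A cop with fewer probes never locates a
  robber who jumps about in \<open>W\<close>: among the vertices of the empty set and of the unprobed singletons at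
  least two are not probed themselves, and both are at distance 1 from every probe
  (\<open>rl_p_G\<close>).

  Subdivide every edge into a path of length \<open>m = 2h\<close> and let the robber walk at unit speed from one
  vertex of \<open>W\<close> to another, over and over. Even if the cop knows the last vertex \<open>y\<close> that he left, half
  of her probes are wasted. While he is closer to \<open>y\<close> than to his goal, the
  shortest way from him to a probe near \<open>u\<close> leads back through \<open>y\<close>, whatever his goal is,
  unless \<open>u\<close> is one of the at most \<open>c\<close> elements of the set of \<open>y\<close>. In the second half of the edge a
  probe reveals, apart from excluding at most two vertices of \<open>W\<close>, only whether one particular
  element of \<open>U\<close> belongs to the set of the goal. So when he arrives, at least \<open>n - c - h\<close> elements of
  \<open>U\<close> have not been tested, and for \<open>h = n - 2c\<close> their \<open>2\<^sup>c\<close> subsets outnumber the roughly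
  \<open>4h\<close> excluded vertices. He can then set out for the next vertex
  (\<open>not_locatable_subdivision\<close>). This gives \<open>rl_s > 2h = 2n - 4c\<close>, and \<open>4c\<close> is about
  \<open>(4 / ln 2) ln n\<close>, where \<open>4 / ln 2 < 5.8\<close>.

  As \<open>rl_s\<close> is a minimum, it says something only if some \<open>s\<close> qualifies at all. Therefore all
  sufficiently long subdivisions are shown to be locatable (\<open>locatable_long_subdivision\<close>).

  Both players' strategies are described by belief sets, the sets of positions that the cop still
  considers possible: \<open>cop_wins\<close> for the cop, and \<open>robber_evades\<close> for the robber.
\<close>

section \<open>Belief sets\<close>

definition closed_nbhd :: "'a pair_pre_digraph \<Rightarrow> 'a set \<Rightarrow> 'a set" where
  "closed_nbhd G C = C \<union> parcs G `` C"

definition answer_class :: "'a pair_pre_digraph \<Rightarrow> 'a list \<Rightarrow> 'a set \<Rightarrow> 'a \<Rightarrow> 'a set" where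
  "answer_class G q S s = {s' \<in> S. map (graph_dist G s') q = map (graph_dist G s) q}"

text \<open>The set \<open>S\<close> is the cop's belief just before a probe. The answers split it into classes; after the
  robber's move the belief is the closed neighbourhood of one of them. An inductive predicate
  makes the number of further probes finite on every branch.\<close>

inductive cop_wins :: "'a pair_pre_digraph \<Rightarrow> nat \<Rightarrow> 'a set \<Rightarrow> bool" for G k where
  cop_winsI: "length q = k \<Longrightarrow> set q \<subseteq> pverts G \<Longrightarrow>
    (\<And>s. s \<in> S \<Longrightarrow> answer_class G q S s \<subseteq> {s} \<or> cop_wins G k (closed_nbhd G (answer_class G q S s)))
    \<Longrightarrow> cop_wins G k S"

lemma closed_nbhd_mono: "C \<subseteq> D \<Longrightarrow> closed_nbhd G C \<subseteq> closed_nbhd G D"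
  by (auto simp: closed_nbhd_def)

lemma cop_wins_mono:
  assumes "cop_wins G k S" "S' \<subseteq> S"
  shows "cop_wins G k S'"
  using assms
proof (induction arbitrary: S' rule: cop_wins.induct)
  case (cop_winsI q S)
  show ?case
  proof (rule cop_wins.cop_winsI[OF cop_winsI.hyps(1,2)])
    fix s assume s: "s \<in> S'"
    have sub: "answer_class G q S' s \<subseteq> answer_class G q S s"
      using cop_winsI.prems by (auto simp: answer_class_def)
    from s cop_winsI.prems have "s \<in> S" by auto
    from cop_winsI.IH[OF this] sub closed_nbhd_mono[OF sub]
    show "answer_class G q S' s \<subseteq> {s} \<or> cop_wins G k (closed_nbhd G (answer_class G q S' s))"
      by blast
  qed
qed

text \<open>The recursion of \<open>answers\<close> appends the latest answer, whereas a strategy assembled from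
  strategies for the classes has to peel off the first one.\<close>

lemma answers_Suc_first:
  "answers G \<sigma> r (Suc t) = map (graph_dist G (r 0)) (\<sigma> []) #
     answers G (\<lambda>h. \<sigma> (map (graph_dist G (r 0)) (\<sigma> []) # h)) (\<lambda>i. r (Suc i)) t"
  by (induction t) auto

lemma robber_walk_tail:
  assumes "robber_walk G r" "r 0 \<in> C"
  shows "robber_walk G (\<lambda>i. r (Suc i)) \<and> r (Suc 0) \<in> closed_nbhd G C"
proof -
  have "r (Suc 0) = r 0 \<or> (r 0, r (Suc 0)) \<in> parcs G"
    using assms(1) by (auto simp: robber_walk_def)
  with assms(2) have "r (Suc 0) \<in> closed_nbhd G C"
    unfolding closed_nbhd_def by (metis ImageI UnI1 UnI2)
  with assms(1) show ?thesis
    by (simp add: robber_walk_def)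
qed

lemma cop_wins_imp_strategy:
  assumes "cop_wins G k S"
  shows "\<exists>\<sigma>. probe_strategy G k \<sigma> \<and> (\<forall>r. robber_walk G r \<and> r 0 \<in> S \<longrightarrow>
    (\<exists>t. \<forall>r'. robber_walk G r' \<and> r' 0 \<in> S \<and> answers G \<sigma> r' (Suc t) = answers G \<sigma> r (Suc t)
       \<longrightarrow> r' t = r t))"
  using assms
proof (induction rule: cop_wins.induct)
  case (cop_winsI q S)
  let ?wins = "\<lambda>\<sigma> S r t. \<forall>r'. robber_walk G r' \<and> r' 0 \<in> S \<and>
    answers G \<sigma> r' (Suc t) = answers G \<sigma> r (Suc t) \<longrightarrow> r' t = r t"
  let ?B = "\<lambda>a. {s \<in> S. map (graph_dist G s) q = a}"
  have "\<exists>\<tau>. probe_strategy G k \<tau> \<and>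
      ((\<exists>s. ?B a \<subseteq> {s}) \<or> (\<forall>r. robber_walk G r \<and> r 0 \<in> closed_nbhd G (?B a) \<longrightarrow>
         (\<exists>t. ?wins \<tau> (closed_nbhd G (?B a)) r t)))" for a
  proof (cases "\<exists>s. ?B a \<subseteq> {s}")
    case True
    with cop_winsI.hyps(1,2) show ?thesis
      by (intro exI[of _ "\<lambda>_. q"]) (auto simp: probe_strategy_def)
  next
    case False
    then obtain s where s: "s \<in> S" "map (graph_dist G s) q = a"
      by blast
    have "answer_class G q S s = ?B a"
      using s by (auto simp: answer_class_def)
    with cop_winsI.IH[OF s(1)] False show ?thesis
      by auto
  qed
  then have "\<exists>\<tau>. \<forall>a. probe_strategy G k (\<tau> a) \<and>
      ((\<exists>s. ?B a \<subseteq> {s}) \<or> (\<forall>r. robber_walk G r \<and> r 0 \<in> closed_nbhd G (?B a) \<longrightarrow>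
         (\<exists>t. ?wins (\<tau> a) (closed_nbhd G (?B a)) r t)))"
    by (intro choice allI)
  then obtain \<tau> where both: "\<forall>a. probe_strategy G k (\<tau> a) \<and>
      ((\<exists>s. ?B a \<subseteq> {s}) \<or> (\<forall>r. robber_walk G r \<and> r 0 \<in> closed_nbhd G (?B a) \<longrightarrow>
         (\<exists>t. ?wins (\<tau> a) (closed_nbhd G (?B a)) r t)))"
    by (rule exE)
  note \<tau> = both[THEN spec, THEN conjunct1] and win = both[THEN spec, THEN conjunct2]
  define \<sigma> where "\<sigma> h = (case h of [] \<Rightarrow> q | a # h' \<Rightarrow> \<tau> a h')" for h
  have "probe_strategy G k \<sigma>"
    unfolding probe_strategy_def
  proof
    show "length (\<sigma> h) = k \<and> set (\<sigma> h) \<subseteq> pverts G" for h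
      using \<tau>[of "hd h", unfolded probe_strategy_def] cop_winsI.hyps(1,2)
      by (cases h) (simp_all add: \<sigma>_def)
  qed
  moreover have "\<exists>t. ?wins \<sigma> S r t" if r: "robber_walk G r" "r 0 \<in> S" for r
  proof -
    let ?a = "map (graph_dist G (r 0)) q"
    have tail: "(\<lambda>h. \<sigma> (a # h)) = \<tau> a" "\<sigma> [] = q" for a
      by (auto simp: \<sigma>_def)
    have walk_tail: "robber_walk G (\<lambda>i. r' (Suc i)) \<and> r' (Suc 0) \<in> closed_nbhd G (?B ?a)"
      if "robber_walk G r'" "r' 0 \<in> S" "map (graph_dist G (r' 0)) q = ?a" for r'
      using robber_walk_tail[OF that(1), of "?B ?a"] that by simp
    show ?thesis
    proof (cases "\<exists>s. ?B ?a \<subseteq> {s}")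
      case True
      then have "?wins \<sigma> S r 0"
        using r(2) by (auto simp: tail)
      then show ?thesis by blast
    next
      case False
      then obtain t where t: "?wins (\<tau> ?a) (closed_nbhd G (?B ?a)) (\<lambda>i. r (Suc i)) t"
        using win[of ?a] walk_tail[OF r] by blast
      have "?wins \<sigma> S r (Suc t)"
      proof (intro allI impI, elim conjE)
        fix r' assume r': "robber_walk G r'" "r' 0 \<in> S"
          and eq: "answers G \<sigma> r' (Suc (Suc t)) = answers G \<sigma> r (Suc (Suc t))"
        from eq have both: "map (graph_dist G (r' 0)) q = ?a \<and>
          answers G (\<tau> (map (graph_dist G (r' 0)) q)) (\<lambda>i. r' (Suc i)) (Suc t)
             = answers G (\<tau> ?a) (\<lambda>i. r (Suc i)) (Suc t)"
          unfolding answers_Suc_first[of G \<sigma> _ "Suc t"] tail by (rule list.inject[THEN iffD1])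
        then have a: "map (graph_dist G (r' 0)) q = ?a"
          by (rule conjunct1)
        from both[THEN conjunct2] have "answers G (\<tau> ?a) (\<lambda>i. r' (Suc i)) (Suc t)
             = answers G (\<tau> ?a) (\<lambda>i. r (Suc i)) (Suc t)"
          unfolding a .
        with t walk_tail[OF r' a] show "r' (Suc t) = r (Suc t)"
          by blast
      qed
      then show ?thesis by blast
    qed
  qed
  ultimately show ?case by blast
qed

lemma cop_wins_imp_locatable:
  assumes "cop_wins G k (pverts G)"
  shows "locatable_with k G"
proof -
  obtain \<sigma> where \<sigma>: "probe_strategy G k \<sigma>" and
    win: "\<And>r. robber_walk G r \<and> r 0 \<in> pverts G \<Longrightarrow> \<exists>t. \<forall>r'. robber_walk G r' \<and> r' 0 \<in> pverts G \<and>
      answers G \<sigma> r' (Suc t) = answers G \<sigma> r (Suc t) \<longrightarrow> r' t = r t"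
    using cop_wins_imp_strategy[OF assms] by blast
  have start: "r 0 \<in> pverts G" if "robber_walk G r" for r
    using that by (simp add: robber_walk_def)
  have "\<exists>t. deduces G \<sigma> r t" if "robber_walk G r" for r
    using win[of r] that start unfolding deduces_def by blast
  with \<sigma> show ?thesis
    unfolding locatable_with_def by blast
qed

text \<open>The compactness principle behind Koenig's lemma: arbitrarily long finite walks yield an infinite one.
  The sets in the proof are infinite sets of indices of walks that agree up to a given time.\<close>

lemma eventually_agreeing_limit:
  fixes w :: "nat \<Rightarrow> nat \<Rightarrow> 'a"
  assumes "finite A" "\<And>T i. w T i \<in> A"
  shows "\<exists>r. \<forall>t. \<exists>T\<ge>t. \<forall>i\<le>t. w T i = r i"
proof -
  have split: "\<exists>N' a. infinite N' \<and> N' \<subseteq> N \<and> (\<forall>T\<in>N'. w T t = a)"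
    if "infinite N" for N :: "nat set" and t
  proof -
    have "finite ((\<lambda>T. w T t) ` N)"
      using assms by (auto intro: finite_subset)
    from pigeonhole_infinite[OF that this] obtain T0
      where "infinite {T \<in> N. w T t = w T0 t}" by auto
    then show ?thesis
      by (intro exI[of _ "{T \<in> N. w T t = w T0 t}"] exI[of _ "w T0 t"]) auto
  qed
  have "\<exists>f. \<forall>t. (infinite (fst (f t)) \<and> (\<forall>T\<in>fst (f t). w T t = snd (f t))) \<and>
      fst (f (Suc t)) \<subseteq> fst (f t)"
  proof (rule dependent_nat_choice)
    show "\<exists>x. infinite (fst x) \<and> (\<forall>T\<in>fst x. w T 0 = snd x)"
      using split[of UNIV 0] by auto
    show "\<exists>y. (infinite (fst y) \<and> (\<forall>T\<in>fst y. w T (Suc t) = snd y)) \<and> fst y \<subseteq> fst x"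
      if "infinite (fst x) \<and> (\<forall>T\<in>fst x. w T t = snd x)" for x t
      using split[of "fst x" "Suc t"] that by auto
  qed
  then obtain f where inf: "\<And>t. infinite (fst (f t))"
    and val: "\<And>t T. T \<in> fst (f t) \<Longrightarrow> w T t = snd (f t)"
    and dec: "\<And>t. fst (f (Suc t)) \<subseteq> fst (f t)"
    by blast
  have "\<exists>T\<ge>t. \<forall>i\<le>t. w T i = snd (f i)" for t
  proof -
    obtain T where T: "T \<ge> t" "T \<in> fst (f t)"
      using inf[of t] by (meson infinite_nat_iff_unbounded_le)
    then have "T \<in> fst (f i)" if "i \<le> t" for i
      using lift_Suc_antimono_le[of "\<lambda>i. fst (f i)", OF dec that] by auto
    with T val show ?thesis by blast
  qed
  then have "\<forall>t. \<exists>T\<ge>t. \<forall>i\<le>t. w T i = snd (f i)" ..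
  then show ?thesis by (rule exI[of _ "\<lambda>i. snd (f i)"])
qed

text \<open>If every belief in \<open>F\<close> has, for each list of probes, a part \<open>C\<close> with at least two
  elements and equal answers such that the neighbourhood of \<open>C\<close> again contains a belief in \<open>F\<close>, the
  robber is never located. The sets \<open>C\<close> chosen one after the other only guarantee that each of their positions is
  reached from the earlier ones. That does not single out one endless walk, because a position may have no
  continuation; such a walk is a limit of ever longer ones.\<close>

lemma robber_evades:
  assumes fin: "finite (pverts G)"
    and start: "S0 \<in> F"
    and F_sub: "\<And>S. S \<in> F \<Longrightarrow> S \<subseteq> pverts G"
    and step: "\<And>S q. S \<in> F \<Longrightarrow> length q = k \<Longrightarrow> set q \<subseteq> pverts G \<Longrightarrow>
      \<exists>C\<subseteq>S. (\<forall>x\<in>C. \<forall>y\<in>C. map (graph_dist G x) q = map (graph_dist G y) q) \<and>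
        (\<exists>x\<in>C. \<exists>y\<in>C. x \<noteq> y) \<and> (\<exists>T\<in>F. T \<subseteq> closed_nbhd G C)"
  shows "\<not> locatable_with k G"
proof
  assume "locatable_with k G"
  then obtain \<sigma> where \<sigma>: "probe_strategy G k \<sigma>"
    and win: "\<And>r. robber_walk G r \<Longrightarrow> \<exists>t. deduces G \<sigma> r t"
    by (auto simp: locatable_with_def)
  let ?ans = "\<lambda>h x. map (graph_dist G x) (\<sigma> h)"
  \<comment> \<open>The pairs of a history and a set \<open>C\<close> are constructed in step, as the next probes depend on the history.\<close>
  define ok where "ok h C \<longleftrightarrow> C \<subseteq> pverts G \<and> (\<forall>x\<in>C. \<forall>y\<in>C. ?ans h x = ?ans h y) \<and>
    (\<exists>x\<in>C. \<exists>y\<in>C. x \<noteq> y) \<and> (\<exists>T\<in>F. T \<subseteq> closed_nbhd G C)" for h C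
  have step': "\<exists>C\<subseteq>S. ok h C" if "S \<in> F" for S h
  proof -
    have "length (\<sigma> h) = k" "set (\<sigma> h) \<subseteq> pverts G"
      using \<sigma> by (auto simp: probe_strategy_def)
    from step[OF that this] F_sub[OF that] show ?thesis
      unfolding ok_def by (meson subset_trans)
  qed
  have "\<exists>f. \<forall>t. (ok (fst (f t)) (snd (f t)) \<and> (t = 0 \<longrightarrow> fst (f t) = [])) \<and>
      (snd (f (Suc t)) \<subseteq> closed_nbhd G (snd (f t)) \<and>
      (\<forall>x\<in>snd (f t). fst (f (Suc t)) = fst (f t) @ [?ans (fst (f t)) x]))"
  proof (rule dependent_nat_choice)
    show "\<exists>x. ok (fst x) (snd x) \<and> (0 = 0 \<longrightarrow> fst x = [])"
      using step'[OF start, of "[]"] by auto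
    fix x :: "history \<times> 'a set" and t :: nat
    assume x: "ok (fst x) (snd x) \<and> (t = 0 \<longrightarrow> fst x = [])"
    obtain h C where [simp]: "x = (h, C)" by force
    have "ok h C" using x by simp
    then obtain c T where c: "c \<in> C" and T: "T \<in> F" "T \<subseteq> closed_nbhd G C"
      unfolding ok_def by blast
    have same: "?ans h y = ?ans h c" if "y \<in> C" for y
      using \<open>ok h C\<close> c that unfolding ok_def by blast
    obtain C' where "C' \<subseteq> T" "ok (h @ [?ans h c]) C'"
      using step'[OF T(1), of "h @ [?ans h c]"] by auto
    then have "(ok (h @ [?ans h c]) C' \<and> (Suc t = 0 \<longrightarrow> h @ [?ans h c] = [])) \<and>
        (C' \<subseteq> closed_nbhd G C \<and> (\<forall>z\<in>C. h @ [?ans h c] = h @ [?ans h z]))"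
      using T(2) same by simp
    then show "\<exists>y. (ok (fst y) (snd y) \<and> (Suc t = 0 \<longrightarrow> fst y = [])) \<and>
        (snd y \<subseteq> closed_nbhd G (snd x) \<and> (\<forall>z\<in>snd x. fst y = fst x @ [?ans (fst x) z]))"
      by (intro exI[of _ "(h @ [?ans h c], C')"]) simp
  qed
  then obtain f where f: "\<And>t. ok (fst (f t)) (snd (f t))" "fst (f 0) = []"
    "\<And>t. snd (f (Suc t)) \<subseteq> closed_nbhd G (snd (f t))"
    "\<And>t x. x \<in> snd (f t) \<Longrightarrow> fst (f (Suc t)) = fst (f t) @ [?ans (fst (f t)) x]"
    by blast
  define H where "H t = fst (f t)" for t
  define C where "C t = snd (f t)" for t
  have answers: "answers G \<sigma> r t = H t" if "\<And>i. i < t \<Longrightarrow> r i \<in> C i" for r t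
    using that
  proof (induction t)
    case (Suc t)
    then show ?case using f(4)[of "r t" t] by (simp add: H_def C_def)
  qed (use f(2) in \<open>simp add: H_def\<close>)
  have reach: "\<exists>r. robber_walk G r \<and> r t = x \<and> (\<forall>i\<le>t. r i \<in> C i)" if "x \<in> C t" for x t
    using that
  proof (induction t arbitrary: x)
    case 0
    with f(1)[of 0] show ?case
      by (intro exI[of _ "\<lambda>_. x"]) (auto simp: robber_walk_def ok_def C_def)
  next
    case (Suc t)
    have x: "x \<in> pverts G" using f(1)[of "Suc t"] Suc.prems by (auto simp: ok_def C_def)
    from f(3)[of t] Suc.prems obtain y where y: "y \<in> C t" "x = y \<or> (y, x) \<in> parcs G"
      by (auto simp: C_def closed_nbhd_def)
    from Suc.IH[OF y(1)] obtain r where r: "robber_walk G r" "r t = y" "\<forall>i\<le>t. r i \<in> C i"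
      by blast
    show ?case
    proof (intro exI[of _ "\<lambda>i. if i \<le> t then r i else x"] conjI)
      show "robber_walk G (\<lambda>i. if i \<le> t then r i else x)"
        unfolding robber_walk_def
      proof
        fix i
        consider "i < t" | "i = t" | "i > t" by linarith
        then show "(if i \<le> t then r i else x) \<in> pverts G \<and>
           ((if Suc i \<le> t then r (Suc i) else x) = (if i \<le> t then r i else x) \<or>
           ((if i \<le> t then r i else x), (if Suc i \<le> t then r (Suc i) else x)) \<in> parcs G)"
          using r x y by cases (auto simp: robber_walk_def)
      qed
    qed (use r Suc.prems in \<open>auto simp: le_Suc_eq\<close>)
  qed
  have "\<exists>r. robber_walk G r \<and> (\<forall>i\<le>t. r i \<in> C i)" for t
    using f(1)[of t] reach[of _ t] unfolding ok_def C_def by blast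
  then have "\<exists>w. \<forall>T. robber_walk G (w T) \<and> (\<forall>i\<le>T. w T i \<in> C i)"
    by (intro choice allI)
  then obtain w where w: "\<And>T. robber_walk G (w T)" "\<And>T i. i \<le> T \<Longrightarrow> w T i \<in> C i"
    by blast
  obtain r where r: "\<And>t. \<exists>T\<ge>t. \<forall>i\<le>t. w T i = r i"
    using eventually_agreeing_limit[OF fin, of w] w(1) unfolding robber_walk_def by blast
  have rC: "r t \<in> C t" for t
    using r[of t] w(2) by force
  have "robber_walk G r"
    unfolding robber_walk_def
  proof
    fix t
    obtain T where "\<forall>i\<le>Suc t. w T i = r i" using r[of "Suc t"] by blast
    then have "w T t = r t" "w T (Suc t) = r (Suc t)" by auto
    then show "r t \<in> pverts G \<and> (r (Suc t) = r t \<or> (r t, r (Suc t)) \<in> parcs G)"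
      using w(1)[of T] unfolding robber_walk_def by metis
  qed
  from win[OF this] obtain t where t: "deduces G \<sigma> r t" by blast
  obtain x where x: "x \<in> C t" "x \<noteq> r t"
    using f(1)[of t] unfolding ok_def C_def by blast
  from reach[OF x(1)] obtain r' where r': "robber_walk G r'" "r' t = x" "\<forall>i\<le>t. r' i \<in> C i"
    by blast
  have "answers G \<sigma> r' (Suc t) = answers G \<sigma> r (Suc t)"
  proof -
    have "answers G \<sigma> r' (Suc t) = H (Suc t)"
      using r'(3) by (intro answers) auto
    moreover have "answers G \<sigma> r (Suc t) = H (Suc t)"
      using rC by (intro answers) auto
    ultimately show ?thesis by (rule trans[OF _ sym])
  qed
  moreover have "r'' t = r t"
    if "robber_walk G r''" "answers G \<sigma> r'' (Suc t) = answers G \<sigma> r (Suc t)" for r''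
    using t[unfolded deduces_def, rule_format, OF conjI[OF that]] .
  ultimately have "r' t = r t"
    using r'(1) by blast
  with r'(2) x(2) show False by simp
qed

section \<open>Distances in subdivided graphs\<close>

text \<open>These conditions determine the distance to \<open>q\<close>: the Lipschitz condition bounds it from
  below along every walk, and descending towards \<open>q\<close> produces a walk that attains the bound.\<close>

definition distance_to :: "'a pair_pre_digraph \<Rightarrow> 'a \<Rightarrow> ('a \<Rightarrow> nat) \<Rightarrow> bool" where
  "distance_to G q f \<longleftrightarrow> f q = 0 \<and> (\<forall>u v. (u, v) \<in> parcs G \<longrightarrow> f u \<le> f v + 1) \<and>
     (\<forall>u\<in>pverts G. u \<noteq> q \<longrightarrow> (\<exists>v. (u, v) \<in> parcs G \<and> f v < f u))"

lemma graph_dist_eqI: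
  assumes "pair_graph G" "q \<in> pverts G" "distance_to G q f" "v \<in> pverts G"
  shows "graph_dist G v q = ereal (real (f v))"
proof -
  interpret pair_graph G by fact
  have cost: "awalk_cost (\<lambda>_. 1) p = real (length p)" for p
    by (induction p) auto
  have lower: "f u \<le> length p" if "awalk u p q" for u p
    using that
  proof (induction p arbitrary: u)
    case Nil
    then show ?case using assms(3) by (auto simp: awalk_Nil_iff distance_to_def)
  next
    case (Cons e p)
    then have e: "e \<in> parcs G" "fst e = u" "f (snd e) \<le> length p"
      by (auto simp: awalk_Cons_iff)
    then have "f u \<le> f (snd e) + 1"
      using assms(3) unfolding distance_to_def by (metis prod.collapse)
    with e show ?case by simp
  qed
  have upper: "\<exists>p. awalk u p q \<and> length p \<le> f u" if "u \<in> pverts G" for u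
    using that
  proof (induction "f u" arbitrary: u rule: less_induct)
    case less
    show ?case
    proof (cases "u = q")
      case True
      with assms(2) show ?thesis by (intro exI[of _ "[]"]) (auto simp: awalk_Nil_iff)
    next
      case False
      then obtain w where w: "(u, w) \<in> parcs G" "f w < f u"
        using assms(3) less.prems by (auto simp: distance_to_def)
      then obtain p where "awalk w p q" "length p \<le> f w"
        using less.hyps[of w] in_arcsD2 by blast
      with w show ?thesis
        by (intro exI[of _ "(u, w) # p"]) (auto simp: awalk_Cons_iff)
    qed
  qed
  show ?thesis
    unfolding graph_dist_def
  proof (rule antisym)
    obtain p where p: "awalk v p q" "length p \<le> f v"
      using upper[OF assms(4)] by blast
    have "\<mu> (\<lambda>_. 1) v q \<le> ereal (real (length p))"
      using min_cost_le_walk_cost[OF p(1), of "\<lambda>_. 1"] by (simp only: cost)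
    also have "\<dots> \<le> ereal (real (f v))"
      using p(2) by simp
    finally show "\<mu> (\<lambda>_. 1) v q \<le> ereal (real (f v))" .
    show "ereal (real (f v)) \<le> \<mu> (\<lambda>_. 1) v q"
      unfolding \<mu>_def by (rule INF_greatest) (use lower in \<open>auto simp: cost\<close>)
  qed
qed

lemma distance_to_pos:
  assumes "distance_to G q f" "v \<in> pverts G" "v \<noteq> q"
  shows "0 < f v"
  using assms unfolding distance_to_def by (metis gr_zeroI not_less_zero)

text \<open>Points on an edge are counted from either end, so that proofs need not distinguish
  which end is smaller in the order that orients the edges.\<close>

definition edge_point :: "nat \<Rightarrow> 'a::linorder \<Rightarrow> 'a \<Rightarrow> nat \<Rightarrow> 'a subdiv_vertex" where
  "edge_point m u v i = (if u < v then path_vertex m u v i else path_vertex m v u (m - i))"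

lemma edge_point_ends [simp]:
  "0 < m \<Longrightarrow> u \<noteq> v \<Longrightarrow> edge_point m u v 0 = Orig u"
  "0 < m \<Longrightarrow> u \<noteq> v \<Longrightarrow> edge_point m u v m = Orig v"
  by (auto simp: edge_point_def path_vertex_def)

lemma edge_point_rev: "u \<noteq> v \<Longrightarrow> i \<le> m \<Longrightarrow> edge_point m v u (m - i) = edge_point m u v i"
  by (auto simp: edge_point_def)

lemma edge_point_inj:
  assumes "edge_point m u v i = edge_point m u w i" "u \<noteq> v" "u \<noteq> w" "0 < i" "i \<le> m"
  shows "v = w"
  using assms by (auto simp: edge_point_def path_vertex_def split: if_splits)

text \<open>An integer-valued distance function \<open>d\<close> in place of \<open>graph_dist\<close>, whose values are extended reals.\<close>

locale metric_graph = pair_graph G for G :: "'a::linorder pair_pre_digraph" +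
  fixes d :: "'a \<Rightarrow> 'a \<Rightarrow> nat"
  assumes dist: "q \<in> pverts G \<Longrightarrow> distance_to G q (\<lambda>x. d x q)"
    and d_sym: "d x y = d y x"
begin

lemma arc_sym: "(u, v) \<in> parcs G \<Longrightarrow> (v, u) \<in> parcs G"
  using pair_sym_arcs by (auto simp: symmetric_def sym_def)

lemma arc_neq: "(u, v) \<in> parcs G \<Longrightarrow> u \<noteq> v"
  using pair_no_loops by fastforce

lemma graph_dist_eq: "x \<in> pverts G \<Longrightarrow> y \<in> pverts G \<Longrightarrow> graph_dist G x y = ereal (real (d x y))"
  using graph_dist_eqI[OF _ _ dist] pair_graph_axioms by blast

lemma d_self: "x \<in> pverts G \<Longrightarrow> d x x = 0"
  using dist by (auto simp: distance_to_def)

lemma d_step: "(u, v) \<in> parcs G \<Longrightarrow> q \<in> pverts G \<Longrightarrow> d u q \<le> d v q + 1"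
  using dist[of q] by (auto simp: distance_to_def)

lemma d_descend: "u \<in> pverts G \<Longrightarrow> q \<in> pverts G \<Longrightarrow> u \<noteq> q \<Longrightarrow> \<exists>v. (u, v) \<in> parcs G \<and> d v q < d u q"
  using dist[of q] by (auto simp: distance_to_def)

lemma d_pos: "x \<in> pverts G \<Longrightarrow> y \<in> pverts G \<Longrightarrow> x \<noteq> y \<Longrightarrow> 0 < d x y"
  using distance_to_pos[OF dist] by blast

lemma d_arc: "(u, v) \<in> parcs G \<Longrightarrow> d u v = 1"
  using d_step[of u v v] d_pos[of u v] d_self[of v] arc_neq[of u v] in_arcsD1[of u v] in_arcsD2[of u v]
  by fastforce

lemma connected_if_distance:
  assumes "pverts G \<noteq> {}"
  shows "Digraph_Component.connected (with_proj G)"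
proof -
  have "u \<rightarrow>\<^sup>*\<^bsub>with_proj G\<^esub> q" if "u \<in> pverts G" "q \<in> pverts G" for u q
    using that
  proof (induction "d u q" arbitrary: u rule: less_induct)
    case less
    show ?case
    proof (cases "u = q")
      case False
      then obtain v where "(u, v) \<in> parcs G" "d v q < d u q"
        using d_descend[OF less.prems] by blast
      moreover from this have "v \<rightarrow>\<^sup>*\<^bsub>with_proj G\<^esub> q"
        using less in_arcsD2 by blast
      ultimately show ?thesis
        using adj_reachable_trans by blast
    qed (use less.prems in simp)
  qed
  then have "u \<rightarrow>\<^sup>*\<^bsub>with_proj (mk_symmetric (with_proj G))\<^esub> q"
    if "u \<in> pverts G" "q \<in> pverts G" for u q
    using that reachable_mk_symmetricI by blast
  then show ?thesis
    using assms by (auto simp: Digraph_Component.connected_def strongly_connected_def)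
qed

end

locale subdivided_graph = metric_graph +
  fixes m :: nat
  assumes m_pos: "0 < m"
begin

abbreviation S where "S \<equiv> equal_subdivision G m"
abbreviation pt where "pt \<equiv> edge_point m"

lemma S_pair_graph: "pair_graph S"
  using pair_graph_equal_subdivision[OF _ m_pos] pair_graph_axioms by blast

lemma pt_ends: "(u, v) \<in> parcs G \<Longrightarrow> pt u v 0 = Orig u" "(u, v) \<in> parcs G \<Longrightarrow> pt u v m = Orig v"
  using m_pos arc_neq by auto

lemma pt_rev: "(u, v) \<in> parcs G \<Longrightarrow> i \<le> m \<Longrightarrow> pt v u (m - i) = pt u v i"
  using arc_neq edge_point_rev by blast

lemma S_arc: "(u, v) \<in> parcs G \<Longrightarrow> i < m \<Longrightarrow> (pt u v i, pt u v (Suc i)) \<in> parcs S"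
proof (cases "u < v")
  case True
  moreover assume "(u, v) \<in> parcs G" "i < m"
  ultimately show ?thesis
    unfolding equal_subdivision_def Let_def edge_point_def by auto
next
  case False
  assume uv: "(u, v) \<in> parcs G" "i < m"
  then have vu: "(v, u) \<in> parcs G" "v < u" "m - Suc i < m" "m - i = Suc (m - Suc i)"
    using False arc_sym[OF uv(1)] arc_neq[OF uv(1)] by auto
  then have "(path_vertex m v u (m - Suc i), path_vertex m v u (m - i)) \<in>
    {(path_vertex m u v i, path_vertex m u v (Suc i)) | u v i.
                 (u, v) \<in> parcs G \<and> u < v \<and> i < m}"
    unfolding vu(4) by blast
  then show ?thesis
    using False unfolding equal_subdivision_def Let_def edge_point_def by simp
qed

lemma S_arc_rev: "(u, v) \<in> parcs G \<Longrightarrow> i < m \<Longrightarrow> (pt u v (Suc i), pt u v i) \<in> parcs S"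
  using S_arc[OF arc_sym, of u v "m - Suc i"] pt_rev[of u v i] pt_rev[of u v "Suc i"]
  by (simp add: Suc_diff_Suc)

lemma S_arcE:
  assumes "(P, Q) \<in> parcs S"
  obtains u v i where "(u, v) \<in> parcs G" "i < m" "P = pt u v i" "Q = pt u v (Suc i)"
proof -
  from assms obtain u v i where uv: "(u, v) \<in> parcs G" "u < v" "i < m" and
    "(P = path_vertex m u v i \<and> Q = path_vertex m u v (Suc i)) \<or>
     (Q = path_vertex m u v i \<and> P = path_vertex m u v (Suc i))"
    by (auto simp: equal_subdivision_def Let_def)
  then consider "P = pt u v i" "Q = pt u v (Suc i)" | "Q = pt u v i" "P = pt u v (Suc i)"
    by (auto simp: edge_point_def)
  then show thesis
  proof cases
    case 1
    with uv that show thesis by blast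
  next
    case 2
    then have "P = pt v u (m - Suc i)" "Q = pt v u (Suc (m - Suc i))"
      using pt_rev[OF uv(1), of i] pt_rev[OF uv(1), of "Suc i"] uv(3) by (auto simp: Suc_diff_Suc)
    with that[of v u "m - Suc i"] uv arc_sym show thesis by auto
  qed
qed

lemma S_vert_Orig: "x \<in> pverts G \<Longrightarrow> Orig x \<in> pverts S"
  by (auto simp: equal_subdivision_def Let_def)

lemma S_vert: "(u, v) \<in> parcs G \<Longrightarrow> i \<le> m \<Longrightarrow> pt u v i \<in> pverts S"
  using in_arcsD1[of u v] in_arcsD2[of u v] arc_sym[of u v] arc_neq[of u v]
  by (cases u v rule: linorder_cases)
    (auto simp: equal_subdivision_def Let_def edge_point_def path_vertex_def)

lemma S_vertE:
  assumes "P \<in> pverts S"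
  obtains x where "x \<in> pverts G" "P = Orig x"
  | u v i where "(u, v) \<in> parcs G" "u < v" "0 < i" "i < m" "P = Inner u v i" "P = pt u v i"
proof -
  from assms consider x where "x \<in> pverts G" "P = Orig x"
    | u v i where "(u, v) \<in> parcs G" "u < v" "0 < i" "i < m" "P = Inner u v i"
    by (auto simp: equal_subdivision_def Let_def)
  then show thesis
    using that by cases (auto simp: edge_point_def path_vertex_def)
qed

text \<open>The distance in the subdivision from the original vertex \<open>x\<close> to the point at position \<open>j\<close> on the edge \<open>ab\<close>:
  a shortest path enters that edge at one of its two ends.\<close>

definition edge_dist where "edge_dist a b j x = min (m * d x a + j) (m * d x b + (m - j))"

lemma edge_dist_rev: "j \<le> m \<Longrightarrow> edge_dist b a (m - j) x = edge_dist a b j x"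
  by (auto simp: edge_dist_def min_def)

lemma edge_dist_step:
  assumes "(u, v) \<in> parcs G" "a \<in> pverts G" "b \<in> pverts G"
  shows "edge_dist a b j u \<le> edge_dist a b j v + m"
proof -
  have "m * d u a \<le> m * (d v a + 1)" "m * d u b \<le> m * (d v b + 1)"
    using mult_le_mono2[OF d_step[OF assms(1,2)]] mult_le_mono2[OF d_step[OF assms(1,3)]] by blast+
  then show ?thesis by (auto simp: edge_dist_def min_def)
qed

lemma edge_dist_left: "(a, b) \<in> parcs G \<Longrightarrow> j \<le> m \<Longrightarrow> edge_dist a b j a = j"
  using d_self[of a] d_arc[of a b] in_arcsD1[of a b] by (auto simp: edge_dist_def)

lemma edge_dist_right: "(a, b) \<in> parcs G \<Longrightarrow> j \<le> m \<Longrightarrow> edge_dist a b j b = m - j"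
  using edge_dist_left[OF arc_sym, of a b "m - j"] edge_dist_rev[of j b a b] by auto

text \<open>The distance to the same point from anywhere. A robber on another edge leaves it at one of
  its ends; on the edge \<open>ab\<close> itself the direct way is shortest.\<close>

definition subdivision_dist where
  "subdivision_dist a b j P = (case P of Orig x \<Rightarrow> edge_dist a b j x
    | Inner u v i \<Rightarrow> if u = a \<and> v = b then (i - j) + (j - i)
        else min (edge_dist a b j u + i) (edge_dist a b j v + (m - i)))"

lemma subdivision_dist_pt_less:
  assumes ab: "(a, b) \<in> parcs G" "a < b" "j \<le> m"
    and uv: "(u, v) \<in> parcs G" "u < v" "i \<le> m"
  shows "subdivision_dist a b j (pt u v i) = (if u = a \<and> v = b then (i - j) + (j - i)
    else min (edge_dist a b j u + i) (edge_dist a b j v + (m - i)))"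
proof -
  have "edge_dist a b j u \<le> edge_dist a b j v + m" "edge_dist a b j v \<le> edge_dist a b j u + m"
    using edge_dist_step uv(1) arc_sym ab in_arcsD1 in_arcsD2 by blast+
  then show ?thesis
    using uv edge_dist_left[OF ab(1,3)] edge_dist_right[OF ab(1,3)] ab(3)
    by (auto simp: subdivision_dist_def edge_point_def path_vertex_def)
qed

lemma subdivision_dist_pt:
  assumes ab: "(a, b) \<in> parcs G" "a < b" "j \<le> m" and uv: "(u, v) \<in> parcs G" "i \<le> m"
  shows "subdivision_dist a b j (pt u v i) = (if u = a \<and> v = b then (i - j) + (j - i)
    else if u = b \<and> v = a then ((m - i) - j) + (j - (m - i))
    else min (edge_dist a b j u + i) (edge_dist a b j v + (m - i)))"
proof (cases "u < v")
  case True
  with ab(2) have "\<not> (u = b \<and> v = a)" by auto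
  then show ?thesis
    unfolding subdivision_dist_pt_less[OF ab uv(1) True uv(2)] by (simp only: if_False)
next
  case False
  with arc_neq[OF uv(1)] have less: "v < u" by auto
  with ab(2) have no: "\<not> (u = a \<and> v = b)" by auto
  have "subdivision_dist a b j (pt u v i) = (if v = a \<and> u = b then ((m - i) - j) + (j - (m - i))
    else min (edge_dist a b j v + (m - i)) (edge_dist a b j u + (m - (m - i))))"
    using subdivision_dist_pt_less[OF ab arc_sym[OF uv(1)] less, of "m - i"]
    by (simp only: pt_rev[OF uv] diff_le_self simp_thms)
  also have "m - (m - i) = i"
    using uv(2) by simp
  finally show ?thesis
    using no by (simp only: if_False min.commute conj_commute)
qed

lemma distance_to_subdivision_dist:
  assumes ab: "(a, b) \<in> parcs G" "a < b" "j \<le> m"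
  shows "distance_to S (pt a b j) (subdivision_dist a b j)"
  unfolding distance_to_def
proof (intro conjI allI impI ballI)
  note pt = subdivision_dist_pt[OF ab]
  have V: "a \<in> pverts G" "b \<in> pverts G" using ab in_arcsD1 in_arcsD2 by auto
  show "subdivision_dist a b j (pt a b j) = 0"
    using pt[OF ab(1,3)] by simp
  show "subdivision_dist a b j P \<le> subdivision_dist a b j Q + 1" if "(P, Q) \<in> parcs S" for P Q
    using that
  proof (rule S_arcE)
    fix u v i assume uv: "(u, v) \<in> parcs G" "i < m" and PQ: "P = pt u v i" "Q = pt u v (Suc i)"
    have 1: "(i - j) + (j - i) \<le> (Suc i - j) + (j - Suc i) + 1"
      by simp
    have 2: "(m - i - j) + (j - (m - i)) \<le> (m - Suc i - j) + (j - (m - Suc i)) + 1"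
      by simp
    have 3: "min (edge_dist a b j u + i) (edge_dist a b j v + (m - i)) \<le>
        min (edge_dist a b j u + Suc i) (edge_dist a b j v + (m - Suc i)) + 1"
      by simp
    from uv have "i \<le> m" "Suc i \<le> m" by auto
    note E = pt[OF uv(1) \<open>i \<le> m\<close>] pt[OF uv(1) \<open>Suc i \<le> m\<close>]
    show ?thesis
    proof (cases "u = a \<and> v = b")
      case True
      from 1 show ?thesis unfolding PQ E if_P[OF True] .
    next
      case no: False
      show ?thesis
      proof (cases "u = b \<and> v = a")
        case True
        from 2 show ?thesis unfolding PQ E if_not_P[OF no] if_P[OF True] .
      next
        case False
        from 3 show ?thesis unfolding PQ E if_not_P[OF no] if_not_P[OF False] .
      qed
    qed
  qed
  fix P assume P: "P \<in> pverts S" "P \<noteq> pt a b j"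
  from P(1) show "\<exists>Q. (P, Q) \<in> parcs S \<and> subdivision_dist a b j Q < subdivision_dist a b j P"
  proof (cases rule: S_vertE)
    case (1 x)
    have Px: "subdivision_dist a b j P = edge_dist a b j x" "P = pt x z 0" if "(x, z) \<in> parcs G" for z
      using 1 that pt_ends by (auto simp: subdivision_dist_def)
    have move: ?thesis if "(x, z) \<in> parcs G" "subdivision_dist a b j (pt x z 1) < edge_dist a b j x" for z
      using S_arc[of x z 0] that Px[OF that(1)] m_pos by auto
    \<comment> \<open>From an end of \<open>ab\<close> one moves along \<open>ab\<close>; elsewhere towards the end that attains the minimum.\<close>
    consider "x = a" | "x = b" | "x \<noteq> a" "x \<noteq> b" by blast
    then show ?thesis
    proof cases
      assume x: "x = a"
      have "j \<noteq> 0"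
      proof
        assume "j = 0"
        with P(2) Px(2)[of b] ab x show False by simp
      qed
      then show ?thesis
        using move[of b] pt[OF ab(1), of 1] ab m_pos edge_dist_left[OF ab(1,3)] x by simp
    next
      assume x: "x = b"
      have "j \<noteq> m"
      proof
        assume "j = m"
        with P(2) Px(2)[of a] pt_rev[OF ab(1), of m] arc_sym[OF ab(1)] x show False by simp
      qed
      then show ?thesis
        using move[of a] pt[OF arc_sym[OF ab(1)], of 1] arc_sym[OF ab(1)] ab m_pos
          edge_dist_right[OF ab(1,3)] x arc_neq[OF ab(1)] by simp
    next
      assume x: "x \<noteq> a" "x \<noteq> b"
      have "\<exists>z. (x, z) \<in> parcs G \<and> edge_dist a b j z + m \<le> edge_dist a b j x"
      proof -
        have drop: "\<exists>z. (x, z) \<in> parcs G \<and> m * d z q + m \<le> m * d x q"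
          if q: "q \<in> pverts G" "x \<noteq> q" for q
        proof -
          obtain z where z: "(x, z) \<in> parcs G" "d z q < d x q"
            using d_descend[OF 1(1) q] by blast
          then have "m * (d z q + 1) \<le> m * d x q"
            by (intro mult_le_mono2) simp
          with z show ?thesis by auto
        qed
        show ?thesis
        proof (cases "m * d x a + j \<le> m * d x b + (m - j)")
          case True
          obtain z where "(x, z) \<in> parcs G" "m * d z a + m \<le> m * d x a"
            using drop[of a] V x by blast
          with True show ?thesis by (intro exI[of _ z]) (auto simp: edge_dist_def)
        next
          case False
          obtain z where "(x, z) \<in> parcs G" "m * d z b + m \<le> m * d x b"
            using drop[of b] V x by blast
          with False show ?thesis by (intro exI[of _ z]) (auto simp: edge_dist_def)
        qed
      qed
      then obtain z where z: "(x, z) \<in> parcs G" "edge_dist a b j z + m \<le> edge_dist a b j x" by blast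
      then show ?thesis
        using move[OF z(1)] pt[OF z(1), of 1] x m_pos by auto
    qed
  next
    case (2 u v i)
    have fwd: "(P, pt u v (Suc i)) \<in> parcs S" and bwd: "(P, pt u v (i - 1)) \<in> parcs S"
      using S_arc[OF 2(1), of i] S_arc_rev[OF 2(1), of "i - 1"] 2 by auto
    have val: "subdivision_dist a b j (pt u v k) = (if u = a \<and> v = b then (k - j) + (j - k)
        else min (edge_dist a b j u + k) (edge_dist a b j v + (m - k)))" if "k \<le> m" for k
      using subdivision_dist_pt_less[OF ab 2(1,2) that] .
    have ij: "i \<noteq> j" if "u = a" "v = b"
      using P(2) 2(6) that by auto
    have 1: "(Suc i - j) + (j - Suc i) < (i - j) + (j - i) \<or>
        (i - 1 - j) + (j - (i - 1)) < (i - j) + (j - i)" if "i \<noteq> j"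
      using that 2(3) by linarith
    have 2: "min (edge_dist a b j u + Suc i) (edge_dist a b j v + (m - Suc i)) < min (edge_dist a b j u + i) (edge_dist a b j v + (m - i)) \<or>
        min (edge_dist a b j u + (i - 1)) (edge_dist a b j v + (m - (i - 1))) < min (edge_dist a b j u + i) (edge_dist a b j v + (m - i))"
      using 2(3,4) by linarith
    have "i \<le> m" "Suc i \<le> m" "i - 1 \<le> m" using \<open>i < m\<close> by auto
    then have "subdivision_dist a b j (pt u v (Suc i)) < subdivision_dist a b j P \<or>
       subdivision_dist a b j (pt u v (i - 1)) < subdivision_dist a b j P"
    proof (cases "u = a \<and> v = b")
      case True
      from 1[OF ij] True show ?thesis
        unfolding \<open>P = pt u v i\<close> val[OF \<open>i \<le> m\<close>] val[OF \<open>Suc i \<le> m\<close>] val[OF \<open>i - 1 \<le> m\<close>] if_P[OF True]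
        by blast
    next
      case False
      from 2 show ?thesis
        unfolding \<open>P = pt u v i\<close> val[OF \<open>i \<le> m\<close>] val[OF \<open>Suc i \<le> m\<close>] val[OF \<open>i - 1 \<le> m\<close>] if_not_P[OF False]
        by blast
    qed
    with fwd bwd show ?thesis by blast
  qed
qed

lemma dist_to_edge_point:
  assumes ab: "(a, b) \<in> parcs G" "j \<le> m" and uv: "(u, v) \<in> parcs G" "i \<le> m" and "{u, v} \<noteq> {a, b}"
  shows "graph_dist S (pt u v i) (pt a b j) =
    ereal (real (min (edge_dist a b j u + i) (edge_dist a b j v + (m - i))))"
proof -
  have no: "\<not> (u = a \<and> v = b)" "\<not> (u = b \<and> v = a)"
    using assms(5) by auto
  show ?thesis
  proof (cases "a < b")
    case True
    show ?thesis
      using subdivision_dist_pt[OF ab(1) True ab(2) uv]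
      unfolding if_not_P[OF no(1)] if_not_P[OF no(2)]
        graph_dist_eqI[OF S_pair_graph S_vert[OF ab] distance_to_subdivision_dist[OF ab(1) True ab(2)]
          S_vert[OF uv]]
      by (rule arg_cong)
  next
    case False
    with arc_neq[OF ab(1)] have less: "b < a" by auto
    note ba = arc_sym[OF ab(1)]
    have "m - j \<le> m" by simp
    show ?thesis
      using subdivision_dist_pt[OF ba less \<open>m - j \<le> m\<close> uv]
      unfolding if_not_P[OF no(1)] if_not_P[OF no(2)] edge_dist_rev[OF ab(2)]
        graph_dist_eqI[OF S_pair_graph S_vert[OF ba \<open>m - j \<le> m\<close>]
          distance_to_subdivision_dist[OF ba less \<open>m - j \<le> m\<close>] S_vert[OF uv],
          unfolded pt_rev[OF ab]]
      by (rule arg_cong)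
  qed
qed

lemma dist_to_Orig:
  assumes yz: "(y, z) \<in> parcs G" and uv: "(u, v) \<in> parcs G" "i \<le> m"
  shows "graph_dist S (pt u v i) (Orig y) =
    ereal (real (min (m * d u y + i) (m * d v y + (m - i))))"
proof -
  have V: "y \<in> pverts G" "z \<in> pverts G" using yz in_arcsD1 in_arcsD2 by auto
  have edge_dist: "edge_dist y z 0 x = m * d x y" if "x \<in> pverts G" for x
  proof -
    have "m * d x y \<le> m * (d x z + 1)"
      using d_step[OF yz that] by (intro mult_le_mono2) (simp add: d_sym)
    then show ?thesis by (simp add: edge_dist_def)
  qed
  have V': "u \<in> pverts G" "v \<in> pverts G" using uv in_arcsD1 in_arcsD2 by auto
  show ?thesis
  proof (cases "{u, v} = {y, z}")
    case False
    then show ?thesis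
      using dist_to_edge_point[OF yz _ uv, of 0] pt_ends(1)[OF yz] edge_dist V' by auto
  next
    case True
    note zy = arc_sym[OF yz]
    have d1: "d y z = 1" "d z y = 1" "d y y = 0" "d z z = 0"
      using d_arc yz zy d_self V by auto
    have uv': "u = y \<and> v = z \<or> u = z \<and> v = y"
      using True arc_neq[OF uv(1)] by (auto simp: doubleton_eq_iff)
    show ?thesis
    proof (cases "y < z")
      case True
      have "graph_dist S (pt u v i) (Orig y) = ereal (real (subdivision_dist y z 0 (pt u v i)))"
        using graph_dist_eqI[OF S_pair_graph S_vert[OF yz]
            distance_to_subdivision_dist[OF yz True] S_vert[OF uv], of 0] pt_ends(1)[OF yz]
        by simp
      moreover have "subdivision_dist y z 0 (pt u v i) = min (m * d u y + i) (m * d v y + (m - i))"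
        using subdivision_dist_pt[OF yz True _ uv, of 0] uv' d1 uv(2) True by auto
      ultimately show ?thesis by simp
    next
      case False
      with arc_neq[OF yz] have less: "z < y" by auto
      have "graph_dist S (pt u v i) (Orig y) = ereal (real (subdivision_dist z y m (pt u v i)))"
        using graph_dist_eqI[OF S_pair_graph S_vert[OF zy]
            distance_to_subdivision_dist[OF zy less] S_vert[OF uv], of m] pt_ends(2)[OF zy]
        by simp
      moreover have "subdivision_dist z y m (pt u v i) = min (m * d u y + i) (m * d v y + (m - i))"
        using subdivision_dist_pt[OF zy less _ uv, of m] uv' d1 uv(2) less by auto
      ultimately show ?thesis by simp
    qed
  qed
qed

end

section \<open>Long subdivisions are locatable\<close>

lemma cop_wins_single_probeI:
  assumes "y \<in> pverts G" "\<And>s. s \<in> S0 \<Longrightarrow> graph_dist G s y = ereal (real (f s))"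
    "\<And>s. s \<in> S0 \<Longrightarrow> {s' \<in> S0. f s' = f s} \<subseteq> {s} \<or> cop_wins G 1 (closed_nbhd G {s' \<in> S0. f s' = f s})"
  shows "cop_wins G 1 S0"
proof (rule cop_winsI[of "[y]"])
  fix s assume s: "s \<in> S0"
  then have "answer_class G [y] S0 s = {s' \<in> S0. f s' = f s}"
    using assms(2) by (auto simp: answer_class_def)
  with assms(3)[OF s]
  show "answer_class G [y] S0 s \<subseteq> {s} \<or> cop_wins G 1 (closed_nbhd G (answer_class G [y] S0 s))"
    by simp
qed (use assms(1) in auto)

context subdivided_graph
begin

text \<open>The distance to the original vertex \<open>y\<close>.\<close>

definition vertex_dist where
  "vertex_dist y P = (case P of Orig x \<Rightarrow> m * d x y
     | Inner u v i \<Rightarrow> min (m * d u y + i) (m * d v y + (m - i)))"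

lemma vertex_dist_pt:
  assumes "(u, v) \<in> parcs G" "i \<le> m" "y \<in> pverts G"
  shows "vertex_dist y (pt u v i) = min (m * d u y + i) (m * d v y + (m - i))"
proof -
  have "m * d u y \<le> m * d v y + m" "m * d v y \<le> m * d u y + m"
    using mult_le_mono2[OF d_step[OF assms(1,3)], of m]
      mult_le_mono2[OF d_step[OF arc_sym[OF assms(1)] assms(3)], of m]
    by auto
  then show ?thesis
    using assms(2) arc_neq[OF assms(1)]
    by (auto simp: vertex_dist_def edge_point_def path_vertex_def min.commute)
qed

lemma exists_arc:
  assumes "parcs G \<noteq> {}" "y \<in> pverts G"
  shows "\<exists>z. (y, z) \<in> parcs G"
proof -
  from assms(1) obtain u v where uv: "(u, v) \<in> parcs G" by auto
  show ?thesis
  proof (cases "u = y")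
    case False
    then show ?thesis using d_descend[OF assms(2) in_arcsD1[OF uv]] by auto
  qed (use uv in auto)
qed

lemma S_vert_pt:
  assumes "parcs G \<noteq> {}" "P \<in> pverts S"
  obtains u v i where "(u, v) \<in> parcs G" "i \<le> m" "P = pt u v i"
  using assms(2)
proof (cases rule: S_vertE)
  case (1 x)
  obtain z where "(x, z) \<in> parcs G" using exists_arc[OF assms(1) 1(1)] by blast
  then show thesis using that[of x z 0] pt_ends 1 by auto
next
  case (2 u v i)
  then show thesis using that[of u v i] by auto
qed

lemma graph_dist_Orig:
  assumes "parcs G \<noteq> {}" "P \<in> pverts S" "y \<in> pverts G"
  shows "graph_dist S P (Orig y) = ereal (real (vertex_dist y P))"
proof -
  obtain u v i where P: "(u, v) \<in> parcs G" "i \<le> m" "P = pt u v i"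
    using S_vert_pt[OF assms(1,2)] .
  obtain z where "(y, z) \<in> parcs G" using exists_arc[OF assms(1,3)] by blast
  then show ?thesis
    using dist_to_Orig[OF _ P(1,2)] vertex_dist_pt[OF P(1,2) assms(3)] P(3) by auto
qed

lemma vertex_dist_step:
  assumes "(P, Q) \<in> parcs S" "y \<in> pverts G"
  shows "vertex_dist y Q \<le> vertex_dist y P + 1"
  using assms(1)
proof (rule S_arcE)
  fix u v i assume *: "(u, v) \<in> parcs G" "i < m" "P = pt u v i" "Q = pt u v (Suc i)"
  have "min (m * d u y + Suc i) (m * d v y + (m - Suc i)) \<le>
      min (m * d u y + i) (m * d v y + (m - i)) + 1"
    by simp
  then show ?thesis
    using vertex_dist_pt[OF *(1) _ assms(2), of i] vertex_dist_pt[OF *(1) _ assms(2), of "Suc i"] *(2-4) by simp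
qed

lemma inner_pt_eq:
  assumes "pt x z p = pt u v i" "0 < p" "p < m" "i \<le> m" "(x, z) \<in> parcs G" "(u, v) \<in> parcs G"
  shows "(u = x \<and> v = z \<and> i = p) \<or> (u = z \<and> v = x \<and> i = m - p)"
  using assms arc_neq[OF assms(5)] arc_neq[OF assms(6)]
  by (auto simp: edge_point_def path_vertex_def split: if_splits)

lemma S_arc_inner:
  assumes "(pt x z p, Q) \<in> parcs S" "0 < p" "p < m" "(x, z) \<in> parcs G"
  shows "Q = pt x z (p - 1) \<or> Q = pt x z (Suc p)"
  using assms(1)
proof (rule S_arcE)
  fix u v i assume *: "(u, v) \<in> parcs G" "i < m" "pt x z p = pt u v i" "Q = pt u v (Suc i)"
  from inner_pt_eq[OF *(3) assms(2,3) _ assms(4) *(1)] *(2)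
  consider "u = x" "v = z" "i = p" | "u = z" "v = x" "i = m - p" by auto
  then show ?thesis
  proof cases
    case 2
    then have "Suc i = m - (p - 1)" using assms(2,3) by auto
    then show ?thesis using pt_rev[OF assms(4), of "p - 1"] *(4) 2 assms(3) by auto
  qed (use *(4) in auto)
qed

definition star where
  "star x Z R = insert (Orig x) {pt x z p | z p. z \<in> Z \<and> 0 < p \<and> p \<le> R}"

lemma closed_nbhd_star:
  assumes "Z \<subseteq> {z. (x, z) \<in> parcs G}" "R < m"
  shows "closed_nbhd S {pt x z p | z p. z \<in> Z \<and> 0 < p \<and> p \<le> R} \<subseteq> star x Z (R + 1)"
proof
  fix Q assume "Q \<in> closed_nbhd S {pt x z p | z p. z \<in> Z \<and> 0 < p \<and> p \<le> R}"
  then obtain z p where zp: "z \<in> Z" "0 < p" "p \<le> R" and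
    Q: "Q = pt x z p \<or> (pt x z p, Q) \<in> parcs S"
    by (auto simp: closed_nbhd_def)
  have xz: "(x, z) \<in> parcs G" using zp assms by auto
  have "Q = pt x z p \<or> Q = pt x z (p - 1) \<or> Q = pt x z (Suc p)"
    using Q S_arc_inner[OF _ zp(2) _ xz] zp assms(2) by auto
  moreover have "pt x z k \<in> star x Z (R + 1)" if "k \<le> R + 1" for k
    using that zp pt_ends(1)[OF xz] by (cases "k = 0") (auto simp: star_def)
  ultimately show "Q \<in> star x Z (R + 1)"
    using zp(3) by auto
qed

lemma star_subset:
  assumes "x \<in> pverts G" "Z \<subseteq> {z. (x, z) \<in> parcs G}" "R \<le> m"
  shows "star x Z R \<subseteq> pverts S"
  using assms S_vert S_vert_Orig by (auto simp: star_def)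

text \<open>Suppose that the robber is on an edge from \<open>x\<close> to some element of \<open>Z\<close>. Probing \<open>y \<in> Z\<close> locates him if he is on
  \<open>xy\<close> or at \<open>x\<close>, as exactly then the answer is at most \<open>m\<close>. Otherwise \<open>y\<close> can be dropped from \<open>Z\<close>: to
  reach \<open>xy\<close> he must stop at \<open>x\<close> at the time of some probe. Each round lets him get one step further
  away, and \<open>R + card Z < m\<close> prevents him from reaching the other end.\<close>

lemma star_wins:
  assumes ne: "parcs G \<noteq> {}" and x: "x \<in> pverts G"
  shows "finite Z \<Longrightarrow> Z \<subseteq> {z. (x, z) \<in> parcs G} \<Longrightarrow> R + card Z < m \<Longrightarrow> cop_wins S 1 (star x Z R)"
proof (induction Z arbitrary: R rule: finite_induct)
  case empty
  have "star x {} R = {Orig x}"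
    by (auto simp: star_def)
  then show ?case
    using x graph_dist_Orig[OF ne S_vert_Orig[OF x] x] S_vert_Orig[OF x]
    by (intro cop_wins_single_probeI[of "Orig x" _ _ "vertex_dist x"]) auto
next
  case (insert y Z)
  have xy: "(x, y) \<in> parcs G" and Z: "Z \<subseteq> {z. (x, z) \<in> parcs G}" and y: "y \<in> pverts G"
    using insert.prems(1) in_arcsD2 by auto
  have R: "R + 1 + card Z < m" "R < m"
    using insert by auto
  have sub: "star x (insert y Z) R \<subseteq> pverts S"
    using star_subset[OF x insert.prems(1)] R by auto
  have D_x: "vertex_dist y (Orig x) = m"
    using d_arc[OF xy] by (simp add: vertex_dist_def)
  have D_y: "vertex_dist y (pt x y p) = m - p" if "p \<le> R" for p
    using that R vertex_dist_pt[OF xy _ y, of p] d_arc[OF xy] d_self[OF y] by auto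
  have D_z: "vertex_dist y (pt x z p) > m" if "z \<in> Z" "0 < p" "p \<le> R" for z p
  proof -
    have xz: "(x, z) \<in> parcs G" using that Z by auto
    then have "0 < d z y" using d_pos[OF in_arcsD2[OF xz] y] insert.hyps(2) that(1) by auto
    then have "m * 1 \<le> m * d z y" by (intro mult_le_mono2) simp
    then have "m < m * d z y + (m - p)"
      using that R by linarith
    moreover have "m < m * d x y + p"
      using that by (simp add: d_arc[OF xy])
    ultimately show ?thesis
      using vertex_dist_pt[OF xz _ y, of p] that R by simp
  qed
  show ?case
  proof (rule cop_wins_single_probeI[of "Orig y" _ _ "vertex_dist y"])
    show "Orig y \<in> pverts S" using S_vert_Orig[OF y] .
    show "graph_dist S s (Orig y) = ereal (real (vertex_dist y s))" if "s \<in> star x (insert y Z) R" for s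
      using graph_dist_Orig[OF ne _ y] sub that by blast
    fix s assume s: "s \<in> star x (insert y Z) R"
    \<comment> \<open>The three alternatives have answer exactly \<open>m\<close>, below \<open>m\<close> and above \<open>m\<close>.\<close>
    have cases: "s' = Orig x \<or> (\<exists>p. s' = pt x y p \<and> 0 < p \<and> p \<le> R) \<or>
        (s' \<in> {pt x z p | z p. z \<in> Z \<and> 0 < p \<and> p \<le> R} \<and> vertex_dist y s' > m)"
      if "s' \<in> star x (insert y Z) R" for s'
      using that D_z unfolding star_def by auto
    let ?C = "{s' \<in> star x (insert y Z) R. vertex_dist y s' = vertex_dist y s}"
    show "?C \<subseteq> {s} \<or> cop_wins S 1 (closed_nbhd S ?C)"
    proof (cases "vertex_dist y s \<le> m")
      case True
      have "s' = s" if s': "s' \<in> ?C" for s'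
      proof -
        have "vertex_dist y s' = vertex_dist y s" "s' \<in> star x (insert y Z) R" using s' by auto
        with cases[OF s] cases[of s'] True consider "s = Orig x" "s' = Orig x"
          | p where "s = pt x y p" "s' = Orig x" "0 < p" "p \<le> R"
          | p where "s' = pt x y p" "s = Orig x" "0 < p" "p \<le> R"
          | p p' where "s = pt x y p" "s' = pt x y p'" "p \<le> R" "p' \<le> R"
          by fastforce
        then show ?thesis
        proof cases
          case (4 p p')
          then have "m - p' = m - p"
            using \<open>vertex_dist y s' = vertex_dist y s\<close> D_y by simp
          then have "p' = p"
            using 4(3,4) R(2) by linarith
          with 4 show ?thesis by simp
        qed (use \<open>vertex_dist y s' = vertex_dist y s\<close> D_x D_y R in auto)
      qed
      then show ?thesis by blast
    next
      case False
      have "?C \<subseteq> {pt x z p | z p. z \<in> Z \<and> 0 < p \<and> p \<le> R}"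
      proof
        fix s' assume "s' \<in> ?C"
        with False have "s' \<in> star x (insert y Z) R" "vertex_dist y s' > m" by auto
        with cases[of s'] D_x D_y show "s' \<in> {pt x z p | z p. z \<in> Z \<and> 0 < p \<and> p \<le> R}"
          by fastforce
      qed
      from subset_trans[OF closed_nbhd_mono[OF this] closed_nbhd_star[OF Z R(2)]]
      show ?thesis using cop_wins_mono[OF insert.IH[OF Z R(1)]] by blast
    qed
  qed
qed

definition near where
  "near L R = {P \<in> pverts S. \<exists>v\<in>L. vertex_dist v P \<le> R}"

lemma near_vertex_subset_star:
  assumes P: "P \<in> pverts S" and v: "v \<in> pverts G" and "vertex_dist v P \<le> R" "R < m"
  shows "P \<in> star v {z. (v, z) \<in> parcs G} R"
  using P
proof (cases rule: S_vertE)
  case (1 x)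
  have "d x v = 0"
  proof (rule ccontr)
    assume "d x v \<noteq> 0"
    then have "m * 1 \<le> m * d x v" by (intro mult_le_mono2) simp
    with assms 1 show False by (simp add: vertex_dist_def)
  qed
  then have "x = v" using d_pos[OF 1(1) v] by auto
  with 1 show ?thesis by (simp add: star_def)
next
  case (2 u w i)
  have uw: "(u, w) \<in> parcs G" by fact
  have far: "m \<le> m * d x v" if "x \<in> pverts G" "x \<noteq> v" for x
  proof -
    have "m * 1 \<le> m * d x v" using d_pos[OF that(1) v that(2)] by (intro mult_le_mono2) simp
    then show ?thesis by simp
  qed
  have min: "min (m * d u v + i) (m * d w v + (m - i)) \<le> R"
    using vertex_dist_pt[OF uw _ v, of i] 2 assms(3) by simp
  then consider "m * d u v + i \<le> R" | "m * d w v + (m - i) \<le> R"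
    by linarith
  then show ?thesis
  proof cases
    case l: 1
    then have "u = v" using far[OF in_arcsD1[OF uw]] assms(4) by fastforce
    moreover from l have "i \<le> R" by simp
    ultimately show ?thesis
      using uw 2(3) unfolding \<open>P = pt u w i\<close> star_def by blast
  next
    case r: 2
    then have "w = v" using far[OF in_arcsD2[OF uw]] assms(4) by fastforce
    moreover from this have "P = pt v u (m - i)" "(v, u) \<in> parcs G"
      using 2 pt_rev[OF uw, of i] arc_sym[OF uw] by auto
    moreover have "0 < m - i" "m - i \<le> R" using r 2(4) by auto
    ultimately show ?thesis unfolding star_def by blast
  qed
qed

text \<open>The cop probes the elements of \<open>L\<close> one after the other. The vertex that the robber was close to at the start
  is recognised when its turn comes, because he has moved away by at most one step per probe. He is then
  in the star of a known vertex.\<close>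

lemma near_wins:
  assumes ne: "parcs G \<noteq> {}"
  shows "finite L \<Longrightarrow> L \<subseteq> pverts G \<Longrightarrow> R + card L + card (pverts G) < m \<Longrightarrow> cop_wins S 1 (near L R)"
proof (induction L arbitrary: R rule: finite_induct)
  case empty
  obtain y where "y \<in> pverts G" using ne in_arcsD1 by auto
  then show ?case
    using S_vert_Orig
    by (intro cop_wins_single_probeI[of "Orig y" _ _ "\<lambda>_. 0"]) (auto simp: near_def)
next
  case (insert v L)
  have v: "v \<in> pverts G" and L: "L \<subseteq> pverts G" and R: "R + 1 + card L + card (pverts G) < m"
    using insert by auto
  let ?N = "{z. (v, z) \<in> parcs G}"
  have fin: "finite ?N" and "?N \<subseteq> pverts G - {v}"
    using in_arcsD2 arc_neq by (auto intro: finite_subset[OF _ pair_finite_verts])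
  then have "card ?N \<le> card (pverts G)"
    by (intro card_mono pair_finite_verts) auto
  then have star: "cop_wins S 1 (star v ?N (R + 1))"
    using R by (intro star_wins ne v fin) auto
  show ?case
  proof (rule cop_wins_single_probeI[of "Orig v" _ _ "vertex_dist v"])
    show "Orig v \<in> pverts S" using S_vert_Orig[OF v] .
    show "graph_dist S s (Orig v) = ereal (real (vertex_dist v s))" if "s \<in> near (insert v L) R" for s
      using graph_dist_Orig[OF ne _ v] that by (auto simp: near_def)
    fix s assume s: "s \<in> near (insert v L) R"
    let ?C = "{s' \<in> near (insert v L) R. vertex_dist v s' = vertex_dist v s}"
    have "cop_wins S 1 (closed_nbhd S ?C)"
    proof (cases "vertex_dist v s \<le> R")
      case True
      have "closed_nbhd S ?C \<subseteq> star v ?N (R + 1)"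
      proof
        fix Q assume "Q \<in> closed_nbhd S ?C"
        then obtain P where P: "P \<in> ?C" "Q = P \<or> (P, Q) \<in> parcs S"
          by (auto simp: closed_nbhd_def)
        from P(1) True have "vertex_dist v P \<le> R" "P \<in> pverts S"
          by (auto simp: near_def)
        moreover have "Q \<in> pverts S"
          using P(2) \<open>P \<in> pverts S\<close> S_pair_graph
          by (auto dest: pair_wf_digraph.in_arcsD2[OF pair_fin_digraph.axioms(1)[OF pair_digraph.axioms(1)[OF pair_graph.axioms(1)]]])
        ultimately have "vertex_dist v Q \<le> R + 1"
          using P(2) vertex_dist_step[of P Q v] v by auto
        with \<open>Q \<in> pverts S\<close> R v show "Q \<in> star v ?N (R + 1)"
          by (intro near_vertex_subset_star) auto
      qed
      then show ?thesis using cop_wins_mono[OF star] by blast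
    next
      case False
      have "closed_nbhd S ?C \<subseteq> near L (R + 1)"
      proof
        fix Q assume "Q \<in> closed_nbhd S ?C"
        then obtain P where P: "P \<in> ?C" "Q = P \<or> (P, Q) \<in> parcs S"
          by (auto simp: closed_nbhd_def)
        from P(1) False obtain w where w: "w \<in> L" "vertex_dist w P \<le> R" "P \<in> pverts S"
          by (auto simp: near_def)
        moreover have "Q \<in> pverts S"
          using P(2) \<open>P \<in> pverts S\<close> S_pair_graph
          by (auto dest: pair_wf_digraph.in_arcsD2[OF pair_fin_digraph.axioms(1)[OF pair_digraph.axioms(1)[OF pair_graph.axioms(1)]]])
        ultimately have "vertex_dist w Q \<le> R + 1"
          using P(2) vertex_dist_step[of P Q w] L by auto
        with w \<open>Q \<in> pverts S\<close> show "Q \<in> near L (R + 1)"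
          by (auto simp: near_def)
      qed
      then show ?thesis using cop_wins_mono[OF insert.IH[OF L R]] by blast
    qed
    then show "?C \<subseteq> {s} \<or> cop_wins S 1 (closed_nbhd S ?C)" ..
  qed
qed

text \<open>Every point is within distance \<open>m div 2\<close> of an original vertex. Probing all vertices and then all
  neighbours of the one found takes at most \<open>2 * card (pverts G)\<close> turns, in which the robber
  must not cover the remaining half of an edge.\<close>

lemma locatable_long_subdivision:
  assumes ne: "parcs G \<noteq> {}" and m: "4 * card (pverts G) < m"
  shows "locatable S"
proof (rule cop_wins_imp_locatable)
  have "pverts S \<subseteq> near (pverts G) (m div 2)"
  proof
    fix P assume P: "P \<in> pverts S"
    obtain u v i where uv: "(u, v) \<in> parcs G" "i \<le> m" "P = pt u v i"
      using S_vert_pt[OF ne P] .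
    have V: "u \<in> pverts G" "v \<in> pverts G" using uv in_arcsD1 in_arcsD2 by auto
    have "vertex_dist u P \<le> i" "vertex_dist v P \<le> m - i"
      using vertex_dist_pt[OF uv(1,2) V(1)] vertex_dist_pt[OF uv(1,2) V(2)] uv(3) d_self[OF V(1)] d_self[OF V(2)] by auto
    then have "vertex_dist u P \<le> m div 2 \<or> vertex_dist v P \<le> m div 2"
      using uv(2) by linarith
    with P V show "P \<in> near (pverts G) (m div 2)"
      by (auto simp: near_def)
  qed
  moreover have "cop_wins S 1 (near (pverts G) (m div 2))"
    using m by (intro near_wins ne pair_finite_verts) auto
  ultimately show "cop_wins S 1 (pverts S)"
    using cop_wins_mono by blast
qed

end

section \<open>A graph coded by small sets\<close>

text \<open>The vertices below \<open>n\<close> form the independent set \<open>U\<close>, and \<open>code A\<close> is the vertex of \<open>A\<close>. The elements of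
  \<open>miss w\<close> are the vertices in \<open>U\<close> that \<open>w \<in> W\<close> is not adjacent to.\<close>

locale miss_graph =
  fixes n c :: nat
  assumes c_pos: "0 < c"
begin

definition code :: "nat set \<Rightarrow> nat" where "code A = n + set_encode A"
definition miss :: "nat \<Rightarrow> nat set" where "miss w = set_decode (w - n)"
definition W :: "nat set" where "W = code ` {A. A \<subseteq> {..<n} \<and> card A \<le> c}"

definition adj :: "nat \<Rightarrow> nat \<Rightarrow> bool" where
  "adj x y \<longleftrightarrow> x \<in> W \<and> y \<in> W \<and> x \<noteq> y \<or> x < n \<and> y \<in> W \<and> x \<notin> miss y \<or> y < n \<and> x \<in> W \<and> y \<notin> miss x"

definition G :: "nat pair_pre_digraph" where
  "G = \<lparr>pverts = {..<n} \<union> W, parcs = {(x, y). adj x y}\<rparr>"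

definition d :: "nat \<Rightarrow> nat \<Rightarrow> nat" where
  "d x y = (if x = y then 0 else if adj x y then 1 else 2)"

lemma miss_code [simp]: "finite A \<Longrightarrow> miss (code A) = A"
  by (simp add: miss_def code_def)

lemma code_miss: "w \<in> W \<Longrightarrow> code (miss w) = w"
  by (auto simp: W_def finite_subset)

lemma code_in_W: "A \<subseteq> {..<n} \<Longrightarrow> card A \<le> c \<Longrightarrow> code A \<in> W"
  by (auto simp: W_def)

lemma miss_W:
  assumes "w \<in> W"
  shows "miss w \<subseteq> {..<n}" "card (miss w) \<le> c" "finite (miss w)"
  using assms by (auto simp: W_def finite_subset dest: subsetD)

lemma code_eq_iff: "finite A \<Longrightarrow> finite B \<Longrightarrow> code A = code B \<longleftrightarrow> A = B"
  using miss_code by metis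

lemma not_code_less [simp]: "\<not> code A < n"
  by (simp add: code_def)

lemma notin_W: "u < n \<Longrightarrow> u \<notin> W"
  by (auto simp: W_def)

lemma finite_W: "finite W"
  unfolding W_def by (rule finite_imageI) (auto intro: finite_subset[of _ "Pow {..<n}"])

lemma empty_code: "code {} \<in> W" "miss (code {}) = {}"
  using code_in_W[of "{}"] by auto

lemma pverts_G [simp]: "pverts G = {..<n} \<union> W"
  and parcs_G [simp]: "(x, y) \<in> parcs G \<longleftrightarrow> adj x y"
  by (auto simp: G_def)

lemma adj_sym: "adj x y \<longleftrightarrow> adj y x"
  by (auto simp: adj_def)

lemma adj_irrefl: "\<not> adj x x"
  by (auto simp: adj_def notin_W)

lemma adj_verts: "adj x y \<Longrightarrow> x \<in> {..<n} \<union> W \<and> y \<in> {..<n} \<union> W"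
  by (auto simp: adj_def)

lemma adj_W: "x \<in> W \<Longrightarrow> y \<in> W \<Longrightarrow> x \<noteq> y \<Longrightarrow> adj x y"
  by (auto simp: adj_def)

lemma adj_mixed: "x \<in> W \<Longrightarrow> u < n \<Longrightarrow> adj x u \<longleftrightarrow> u \<notin> miss x"
  by (auto simp: adj_def notin_W)

lemma adj_empty_code: "x \<in> {..<n} \<union> W \<Longrightarrow> x \<noteq> code {} \<Longrightarrow> adj x (code {})"
  using empty_code by (auto simp: adj_def)

lemma pair_graph_G: "pair_graph G"
proof
  show "finite (parcs G)"
    by (rule finite_subset[of _ "({..<n} \<union> W) \<times> ({..<n} \<union> W)"])
      (use finite_W in \<open>auto simp: G_def dest: adj_verts\<close>)
  show "symmetric G"
    using adj_sym by (auto simp: symmetric_def sym_def)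
  show "finite (pverts G)"
    using finite_W by simp
  fix e assume "e \<in> parcs G"
  then have "adj (fst e) (snd e)"
    by (simp add: G_def case_prod_beta)
  then show "fst e \<in> pverts G" "snd e \<in> pverts G" "fst e \<noteq> snd e"
    using adj_verts[of "fst e" "snd e"] adj_irrefl[of "snd e"] by auto
qed

lemma metric_graph_G: "metric_graph G d"
proof -
  interpret pair_graph G by (rule pair_graph_G)
  show ?thesis
  proof
    show "d x y = d y x" for x y
      by (simp add: d_def adj_sym)
    show "distance_to G q (\<lambda>x. d x q)" if q: "q \<in> pverts G" for q
      unfolding distance_to_def
    proof (intro conjI allI impI ballI)
      show "d q q = 0" by (simp add: d_def)
      show "d u q \<le> d v q + 1" if "(u, v) \<in> parcs G" for u v
        using that by (auto simp: d_def)
      fix u assume u: "u \<in> pverts G" "u \<noteq> q"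
      show "\<exists>v. (u, v) \<in> parcs G \<and> d v q < d u q"
      proof (cases "adj u q")
        case True
        with u show ?thesis by (intro exI[of _ q]) (simp add: d_def)
      next
        case False
        then have "u \<noteq> code {}" "q \<noteq> code {}"
          using u q adj_empty_code adj_sym by auto
        then have "adj u (code {})" "adj (code {}) q"
          using u q adj_empty_code adj_sym by auto
        with u False show ?thesis by (intro exI[of _ "code {}"]) (simp add: d_def)
      qed
    qed
  qed
qed

sublocale metric_graph G d
  by (rule metric_graph_G)

lemma d_W: "x \<in> W \<Longrightarrow> y \<in> W \<Longrightarrow> x \<noteq> y \<Longrightarrow> d x y = 1"
  by (simp add: d_def adj_W)

lemma d_mixed: "x \<in> W \<Longrightarrow> u < n \<Longrightarrow> d x u = (if u \<in> miss x then 2 else 1)"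
  by (auto simp: d_def adj_mixed notin_W)

lemma connected_G: "Digraph_Component.connected (with_proj G)"
  using empty_code(1) by (intro connected_if_distance) auto

lemma locatable_with_n: "locatable_with n G"
proof (rule cop_wins_imp_locatable, rule cop_winsI[of "[0..<n]"])
  fix s assume s: "s \<in> pverts G"
  have "s' = s" if s': "s' \<in> answer_class G [0..<n] (pverts G) s" for s'
  proof -
    have V': "s' \<in> pverts G" using s' by (auto simp: answer_class_def)
    have same: "d s' u = d s u" if "u < n" for u
      using s' graph_dist_eq[OF V', of u] graph_dist_eq[OF s, of u] that
      by (auto simp: answer_class_def)
    show ?thesis
    proof (cases "s < n \<or> s' < n")
      case True
      then show ?thesis using same[of s] same[of s'] by (auto simp: d_def split: if_splits)
    next
      case False
      then have W: "s \<in> W" "s' \<in> W" using s V' by auto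
      have "miss s' = miss s"
        using same d_mixed[OF W(1)] d_mixed[OF W(2)] miss_W(1)[OF W(1)] miss_W(1)[OF W(2)]
        by (auto split: if_splits) (metis lessThan_iff subsetD numeral_eq_one_iff semiring_norm(85))+
      then show ?thesis using code_miss W by metis
    qed
  qed
  then show "answer_class G [0..<n] (pverts G) s \<subseteq> {s} \<or>
      cop_wins G n (closed_nbhd G (answer_class G [0..<n] (pverts G) s))"
    by blast
qed auto

text \<open>Robber positions in \<open>W\<close> that remain possible for a cop who has ruled out \<open>Z\<close> and knows that his vertex is
  adjacent to all of \<open>X\<close>.\<close>

definition candidates :: "nat set \<Rightarrow> nat set \<Rightarrow> nat set" where
  "candidates X Z = {w \<in> W. miss w \<inter> X = {}} - Z"

lemma two_elements: "2 \<le> card A \<Longrightarrow> \<exists>x\<in>A. \<exists>y\<in>A. x \<noteq> y"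
  by (metis One_nat_def Suc_1 card.infinite card_le_Suc0_iff_eq not_less_eq_eq zero_le)

text \<open>A robber confined to the clique \<open>W\<close> can move to any of its vertices, so the belief \<open>W\<close> reproduces itself.
  If \<open>a\<close> of the \<open>k\<close> probes are in \<open>U\<close>, the empty set and the singletons of the unprobed elements of \<open>U\<close>
  provide \<open>n - a + 1\<close> vertices of \<open>W\<close>, at most \<open>k - a\<close> of which are probed.\<close>

lemma not_locatable_with_less:
  assumes "k < n"
  shows "\<not> locatable_with k G"
proof (rule robber_evades[of _ W "{W}"])
  fix A q assume A: "A \<in> {W}" and q: "length q = k" "set q \<subseteq> pverts G"
  define X where "X = set q \<inter> {..<n}"
  define C where "C = candidates X (set q)"
  have C: "C \<subseteq> W" by (auto simp: C_def candidates_def)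
  have one: "d x p = 1" if "x \<in> C" "p \<in> set q" for x p
  proof (cases "p < n")
    case True
    then show ?thesis using that d_mixed[of x p] by (auto simp: C_def candidates_def X_def)
  next
    case False
    then have "p \<in> W" using that(2) q(2) by auto
    then show ?thesis using that d_W[of x p] by (auto simp: C_def candidates_def)
  qed
  have "map (graph_dist G x) q = map (graph_dist G y) q" if "x \<in> C" "y \<in> C" for x y
    using that C q(2) one by (auto simp: graph_dist_eq subset_iff)
  moreover have "2 \<le> card C"
  proof -
    define T where "T = code ` insert {} ((\<lambda>u. {u}) ` ({..<n} - X))"
    have "T - (set q - X) \<subseteq> C"
    proof
      fix w assume w: "w \<in> T - (set q - X)"
      then obtain A where A: "w = code A" "A = {} \<or> (\<exists>u. A = {u} \<and> u < n \<and> u \<notin> X)"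
        by (auto simp: T_def)
      then have "A \<subseteq> {..<n}" "card A \<le> c" "finite A" "A \<inter> X = {}"
        using c_pos by auto
      moreover have "w \<notin> set q"
        using w A(1) by (auto simp: X_def)
      ultimately show "w \<in> C"
        using A(1) code_in_W by (auto simp: C_def candidates_def)
    qed
    moreover have "finite C" using C finite_W by (rule finite_subset)
    ultimately have "card (T - (set q - X)) \<le> card C" by (intro card_mono)
    moreover have "card T - card (set q - X) \<le> card (T - (set q - X))"
      by (intro diff_card_le_card_Diff) simp
    moreover have "card T = n - card X + 1"
    proof -
      have "card T = card (insert {} ((\<lambda>u. {u}) ` ({..<n} - X)))"
        unfolding T_def by (intro card_image inj_onI) (auto simp: code_eq_iff)
      also have "\<dots> = card ({..<n} - X) + 1"
        by (subst card_insert_disjoint) (auto simp: card_image)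
      also have "card ({..<n} - X) = n - card X"
        by (subst card_Diff_subset) (auto simp: X_def)
      finally show ?thesis .
    qed
    moreover have "card (set q - X) = card (set q) - card X"
      by (subst card_Diff_subset) (auto simp: X_def)
    moreover have "card X \<le> card (set q)" by (intro card_mono) (auto simp: X_def)
    moreover have "card (set q) \<le> k" using q(1) card_length by blast
    ultimately show ?thesis using assms by linarith
  qed
  then have two: "\<exists>x\<in>C. \<exists>y\<in>C. x \<noteq> y" by (rule two_elements)
  moreover have "W \<subseteq> closed_nbhd G C"
  proof
    fix w assume w: "w \<in> W"
    from two obtain x where x: "x \<in> C" by blast
    then have "x = w \<or> (x, w) \<in> parcs G"
      using w C adj_W[of x w] by auto
    with x show "w \<in> closed_nbhd G C"
      unfolding closed_nbhd_def by blast
  qed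
  ultimately show "\<exists>C\<subseteq>A. (\<forall>x\<in>C. \<forall>y\<in>C. map (graph_dist G x) q = map (graph_dist G y) q) \<and>
        (\<exists>x\<in>C. \<exists>y\<in>C. x \<noteq> y) \<and> (\<exists>T\<in>{W}. T \<subseteq> closed_nbhd G C)"
    using A C by blast
qed (use finite_W in auto)

lemma rl_p_G: "rl_p G = n"
  unfolding rl_p_def
proof (rule Least_equality)
  show "locatable_with n G" by (rule locatable_with_n)
  show "n \<le> k" if "locatable_with k G" for k
  proof (rule ccontr)
    assume "\<not> n \<le> k"
    then have "k < n" by simp
    from not_locatable_with_less[OF this] that show False by (rule notE)
  qed
qed

lemma finite_candidates: "finite (candidates X Z)"
  using finite_W by (simp add: candidates_def)

text \<open>Already the subsets of \<open>c\<close> elements outside \<open>X\<close> are enough.\<close>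

lemma card_candidates:
  assumes "card X + c \<le> n" "finite X" "finite Z"
  shows "2 ^ c \<le> card (candidates X Z) + card Z"
proof -
  have "c \<le> card ({..<n} - X)"
    using diff_card_le_card_Diff[OF assms(2), of "{..<n}"] assms(1) by simp
  then obtain Y where Y: "Y \<subseteq> {..<n} - X" "card Y = c" "finite Y"
    by (meson obtain_subset_with_card_n)
  have "code A \<in> W" "miss (code A) \<inter> X = {}" if "A \<subseteq> Y" for A
  proof -
    have A: "finite A" "A \<subseteq> {..<n}" "card A \<le> c"
      using that Y card_mono[OF Y(3) that] by (auto intro: finite_subset)
    then show "code A \<in> W" using code_in_W by blast
    show "miss (code A) \<inter> X = {}" using A Y that by auto
  qed
  then have sub: "code ` Pow Y - Z \<subseteq> candidates X Z"
    by (auto simp: candidates_def)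
  have "inj_on code (Pow Y)"
    using Y(3) by (intro inj_onI) (auto simp: code_eq_iff finite_subset)
  then have "2 ^ c = card (code ` Pow Y)"
    using Y by (simp add: card_image card_Pow)
  also have "\<dots> \<le> card (code ` Pow Y - Z) + card Z"
    using diff_card_le_card_Diff[OF assms(3), of "code ` Pow Y"] by simp
  also have "\<dots> \<le> card (candidates X Z) + card Z"
    using card_mono[OF finite_candidates sub] by simp
  finally show ?thesis .
qed

end

section \<open>The robber in the subdivided graph\<close>

locale miss_graph_subdivision = miss_graph +
  fixes h :: nat
  assumes n_eq: "n = 2 * c + h" and h_pos: "0 < h" and many: "4 * h + 3 \<le> 2 ^ c"
begin

sublocale subdivided_graph G d "2 * h"
  using h_pos by unfold_locales simp

lemma parcs_nonempty: "parcs G \<noteq> {}"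
proof -
  have "0 < n" using n_eq h_pos by simp
  then have "(0, code {}) \<in> parcs G" using empty_code by (simp add: adj_def)
  then show ?thesis by blast
qed

text \<open>No two vertices of \<open>U\<close> are adjacent, so every edge has an end in \<open>W\<close>. This is why a probe inside an edge tells no
  more about the set of the robber's goal than a probe at a vertex of \<open>U\<close>.\<close>

lemma probe_normal_form:
  assumes "q \<in> pverts S"
  obtains a b j where "adj a b" "b \<in> W" "j \<le> 2 * h" "q = pt a b j"
proof -
  obtain a b j where ab: "adj a b" "j \<le> 2 * h" "q = pt a b j"
    using S_vert_pt[OF parcs_nonempty assms] by auto
  show thesis
  proof (cases "b \<in> W")
    case False
    then have "a \<in> W" using ab(1) by (auto simp: adj_def)
    moreover have "q = pt b a (2 * h - j)"
      using pt_rev[of a b j] ab by simp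
    ultimately show thesis using that[of b a "2 * h - j"] ab(1) adj_sym by auto
  qed (use ab that in blast)
qed

text \<open>At time \<open>t\<close> the robber is on the way from \<open>y\<close> to an unknown \<open>w\<close>, and the probe is on the edge \<open>ab\<close>. If \<open>a\<close> is
  in \<open>U\<close> and adjacent to \<open>y\<close>, then \<open>y\<close> is at least as close to the probe as any candidate, so in the first half of
  the edge the shortest path goes through \<open>y\<close> and its length does not depend on \<open>w\<close>. In all other cases every
  candidate is adjacent to both \<open>a\<close> and \<open>b\<close>.\<close>

lemma same_answer:
  assumes y: "y \<in> W" and ab: "adj a b" "b \<in> W" "j \<le> 2 * h" and t: "t \<le> 2 * h"
    and X: "miss y \<subseteq> X" "a < n \<Longrightarrow> h < t \<Longrightarrow> a \<in> X"
    and Z: "{y, a, b} \<subseteq> Z"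
    and w: "w \<in> candidates X Z" "w' \<in> candidates X Z"
  shows "graph_dist S (pt y w t) (pt a b j) = graph_dist S (pt y w' t) (pt a b j)"
proof -
  have ab': "(a, b) \<in> parcs G" using ab by simp
  have V: "a \<in> {..<n} \<union> W" using adj_verts[OF ab(1)] by blast
  have dist: "graph_dist S (pt y v t) (pt a b j) =
      ereal (real (min (edge_dist a b j y + t) (edge_dist a b j v + (2 * h - t))))" if "v \<in> candidates X Z" for v
  proof -
    have "v \<in> W" "v \<notin> {y, a, b}" using that Z by (auto simp: candidates_def)
    then show ?thesis
      using y ab' ab(3) t adj_W[of y v] by (intro dist_to_edge_point) (auto simp: doubleton_eq_iff)
  qed
  have db: "d v b = 1" if "v \<in> candidates X Z" for v
    using that Z ab(2) by (intro d_W) (auto simp: candidates_def)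
  show ?thesis
  proof (cases "a < n \<and> t \<le> h \<and> a \<notin> miss y")
    case True
    have "edge_dist a b j y + t \<le> edge_dist a b j v + (2 * h - t)" if v: "v \<in> candidates X Z" for v
    proof -
      have "v \<in> W" using v by (auto simp: candidates_def)
      then have "d y a \<le> d v a" "d y b \<le> d v b"
        using True y ab(2) db[OF v] d_mixed[of y a] d_mixed[of v a] d_W[of y b] d_self[of b]
        by (cases "y = b"; auto)+
      then have "2 * h * d y a \<le> 2 * h * d v a" "2 * h * d y b \<le> 2 * h * d v b"
        by (auto intro: mult_le_mono2)
      then have "edge_dist a b j y \<le> edge_dist a b j v"
        unfolding edge_dist_def by (intro min.mono add_right_mono)
      moreover have "t \<le> 2 * h - t" using True by auto
      ultimately show ?thesis by (rule add_mono)
    qed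
    then show ?thesis using dist w by (simp add: min_absorb1)
  next
    case False
    have "d v a = 1" if v: "v \<in> candidates X Z" for v
    proof (cases "a < n")
      case True
      then have "a \<in> X" using False X by fastforce
      then show ?thesis using v True d_mixed[of v a] by (auto simp: candidates_def)
    next
      case False
      then show ?thesis using V v Z by (intro d_W) (auto simp: candidates_def)
    qed
    then have "edge_dist a b j v = min (2 * h + j) (2 * h + (2 * h - j))" if "v \<in> candidates X Z" for v
      using db that by (simp add: edge_dist_def)
    then show ?thesis using dist w by simp
  qed
qed

text \<open>The robber left \<open>y\<close> and has taken \<open>t\<close> steps, and \<open>t - 1\<close> probes have been made since. The set \<open>miss y\<close> is part of
  \<open>X\<close> from the beginning, because probes near its elements are informative already in the first half; beyond it, \<open>X\<close> grows
  only by the probes after the first \<open>h\<close>. Each probe adds at most two vertices to \<open>Z\<close>.\<close>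

definition beliefs where
  "beliefs = {(\<lambda>w. pt y w t) ` candidates X Z | y t X Z. y \<in> W \<and> 1 \<le> t \<and> t \<le> 2 * h \<and>
     miss y \<subseteq> X \<and> finite X \<and> card X \<le> c + (t - 1 - h) \<and> y \<in> Z \<and> finite Z \<and> card Z \<le> 2 * t - 1}"

lemma beliefs_step:
  assumes B: "B \<in> beliefs" and q: "q \<in> pverts S"
  shows "\<exists>C\<subseteq>B. (\<forall>P\<in>C. \<forall>Q\<in>C. graph_dist S P q = graph_dist S Q q) \<and>
    (\<exists>P\<in>C. \<exists>Q\<in>C. P \<noteq> Q) \<and> (\<exists>T\<in>beliefs. T \<subseteq> closed_nbhd S C)"
proof -
  from B obtain y t X Z where B_eq: "B = (\<lambda>w. pt y w t) ` candidates X Z" and y: "y \<in> W"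
    and t: "1 \<le> t" "t \<le> 2 * h" and X: "miss y \<subseteq> X" "finite X" "card X \<le> c + (t - 1 - h)"
    and Z: "y \<in> Z" "finite Z" "card Z \<le> 2 * t - 1"
    unfolding beliefs_def by blast
  obtain a b j where ab: "adj a b" "b \<in> W" "j \<le> 2 * h" "q = pt a b j"
    using probe_normal_form[OF q] .
  define X' where "X' = (if h < t then insert a X else X)"
  define Z' where "Z' = insert a (insert b Z)"
  have X': "miss y \<subseteq> X'" "finite X'" "card X' \<le> c + (t - h)"
    using X card_insert_le_m1[of "Suc (c + (t - 1 - h))" X a] t
    by (auto simp: X'_def card_insert_if)
  have Z': "finite Z'" "card Z' \<le> 2 * t + 1" "y \<in> Z'"
    using Z t by (auto simp: Z'_def card_insert_if)
  define C where "C = (\<lambda>w. pt y w t) ` candidates X' Z'"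
  have y_adj: "(y, w) \<in> parcs G" if "w \<in> candidates X' Z'" for w
    using that y Z' adj_W[of y w] by (auto simp: candidates_def)
  have "2 ^ c \<le> card (candidates X' Z') + card Z'"
    using X' Z' t n_eq by (intro card_candidates) auto
  then have "2 \<le> card (candidates X' Z')"
    using Z'(2) t many by linarith
  then obtain w1 w2 where w12: "w1 \<in> candidates X' Z'" "w2 \<in> candidates X' Z'" "w1 \<noteq> w2"
    using two_elements by blast
  have "C \<subseteq> B"
    by (auto simp: C_def B_eq candidates_def X'_def Z'_def)
  moreover have "\<forall>P\<in>C. \<forall>Q\<in>C. graph_dist S P q = graph_dist S Q q"
    unfolding C_def ab(4) ball_simps
    by (intro ballI same_answer[OF y ab(1-3) t(2) X'(1)]) (use Z in \<open>auto simp: X'_def Z'_def\<close>)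
  moreover have "pt y w1 t \<noteq> pt y w2 t"
    using edge_point_inj[of "2 * h" y w1 t w2] w12 y_adj[OF w12(1)] y_adj[OF w12(2)] arc_neq t
    by force
  moreover have "\<exists>T\<in>beliefs. T \<subseteq> closed_nbhd S C"
  proof (cases "t < 2 * h")
    case True
    define T where "T = (\<lambda>w. pt y w (Suc t)) ` candidates X' Z'"
    have "T \<in> beliefs"
      unfolding beliefs_def T_def using y X' Z' True
      by (intro CollectI exI[of _ y] exI[of _ "Suc t"] exI[of _ X'] exI[of _ Z'] conjI refl) auto
    moreover have "T \<subseteq> closed_nbhd S C"
      using S_arc[OF y_adj True] by (auto simp: T_def C_def closed_nbhd_def)
    ultimately show ?thesis by blast
  next
    case False
    \<comment> \<open>The robber arrives. Any goal that is still possible serves as the next starting point, now known to the cop.\<close>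
    then have t_eq: "t = 2 * h" using t by simp
    have w1: "w1 \<in> W" using w12 by (auto simp: candidates_def)
    define T where "T = (\<lambda>w. pt w1 w 1) ` candidates (miss w1) {w1}"
    have "T \<in> beliefs"
      unfolding beliefs_def T_def using w1 miss_W[OF w1] h_pos
      by (intro CollectI exI[of _ w1] exI[of _ "1::nat"] exI[of _ "miss w1"] exI[of _ "{w1}"]
          conjI refl) auto
    moreover have "T \<subseteq> closed_nbhd S C"
    proof
      fix P assume "P \<in> T"
      then obtain w where w: "w \<in> candidates (miss w1) {w1}" "P = pt w1 w 1"
        by (auto simp: T_def)
      then have "(w1, w) \<in> parcs G"
        using w1 adj_W[of w1 w] by (auto simp: candidates_def)
      then have "(Orig w1, P) \<in> parcs S"
        using S_arc[of w1 w 0] w(2) h_pos pt_ends(1)[of w1 w] by simp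
      moreover have "Orig w1 \<in> C"
        unfolding C_def t_eq using w12(1) pt_ends(2)[OF y_adj[OF w12(1)]] by (metis imageI)
      ultimately show "P \<in> closed_nbhd S C"
        by (auto simp: closed_nbhd_def)
    qed
    ultimately show ?thesis by blast
  qed
  ultimately show ?thesis
    using w12(1,2) unfolding C_def by blast
qed

lemma not_locatable_subdivision: "\<not> locatable S"
proof (rule robber_evades)
  show "finite (pverts S)"
    using pair_fin_digraph.pair_finite_verts[OF pair_digraph.axioms(1)[OF pair_graph.axioms(1)[OF S_pair_graph]]] .
  show "(\<lambda>w. pt (code {}) w 1) ` candidates {} {code {}} \<in> beliefs"
    unfolding beliefs_def using h_pos empty_code
    by (intro CollectI exI[of _ "code {}"] exI[of _ "1::nat"] exI[of _ "{}"] exI[of _ "{code {}}"]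
          conjI refl) auto
  show "B \<subseteq> pverts S" if "B \<in> beliefs" for B
  proof
    fix P assume "P \<in> B"
    with that obtain y w t where "P = pt y w t" "y \<in> W" "w \<in> W" "y \<noteq> w" "t \<le> 2 * h"
      by (auto simp: beliefs_def candidates_def)
    then show "P \<in> pverts S" using S_vert[of y w t] adj_W[of y w] by simp
  qed
  fix B q assume B: "B \<in> beliefs" and q: "length q = 1" "set q \<subseteq> pverts S"
  from q obtain p where "q = [p]" "p \<in> pverts S"
    by (cases q) auto
  then show "\<exists>C\<subseteq>B. (\<forall>x\<in>C. \<forall>y\<in>C. map (graph_dist S x) q = map (graph_dist S y) q) \<and>
        (\<exists>x\<in>C. \<exists>y\<in>C. x \<noteq> y) \<and> (\<exists>T\<in>beliefs. T \<subseteq> closed_nbhd S C)"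
    using beliefs_step[OF B] by simp
qed

lemma rl_s_gt: "2 * h < rl_s G"
proof -
  let ?good = "\<lambda>s. 0 < s \<and> (\<forall>m\<ge>s. locatable (equal_subdivision G m))"
  have "?good (4 * card (pverts G) + 1)"
  proof (intro conjI allI impI)
    fix m assume m: "4 * card (pverts G) + 1 \<le> m"
    interpret long: subdivided_graph G d m
      using m by unfold_locales simp
    show "locatable (equal_subdivision G m)"
      using m by (intro long.locatable_long_subdivision parcs_nonempty) simp
  qed simp
  then have "?good (rl_s G)"
    unfolding rl_s_def by (rule LeastI)
  then show ?thesis
    using not_locatable_subdivision by (meson not_le_imp_less)
qed

end

text \<open>The exponent is chosen with \<open>2\<^sup>c \<le> 8n\<close>, and the coarse bound \<open>ln 2 \<ge> 3/5\<close> gives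
  \<open>4c \<le> (20/3) ln n + 12\<close>. This is at most \<open>7.2 ln n\<close> as soon as \<open>ln n\<close> is at least 22.5.\<close>

lemma logarithmic_exponent:
  fixes n :: nat
  assumes "exp 23 \<le> real n"
  obtains c where "0 < c" "4 * n \<le> 2 ^ c" "2 * c < n" "4 * real c \<le> 7.2 * ln (real n)"
proof -
  define L where "L = ln (real n)"
  have "(1::real) \<le> exp 23" by simp
  with assms have n: "0 < real n" "1 \<le> n" by linarith+
  have L: "23 \<le> L"
    unfolding L_def using assms n by (simp add: ln_ge_iff)
  obtain e where e: "2 ^ e \<le> n" "n < 2 ^ (e + 1)"
    using ex_power_ivl1[of 2 n] n by auto
  have "real e * ln 2 = ln (2 ^ e)"
    by (simp add: ln_realpow)
  also have "\<dots> \<le> L"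
    unfolding L_def using e(1) n by (intro ln_mono) (auto simp: numeral_power_le_of_nat_cancel_iff)
  finally have "real e * ln 2 \<le> L" .
  moreover have "3 / 5 \<le> ln (2 :: real)"
  proof -
    have "exp (3 / 5) \<le> (2 :: real)"
      using exp_bound[of "3 / 5"] by (simp add: power2_eq_square)
    then show ?thesis
      by (rule ln_ge_iff[THEN iffD2, rotated]) simp
  qed
  ultimately have "real e * (3 / 5) \<le> L"
    using mult_left_mono[of "3 / 5" "ln 2" "real e"] by linarith
  then have c: "4 * real (e + 3) \<le> 7.2 * L"
    using L by simp
  \<comment> \<open>This makes \<open>L\<^sup>2 / 2\<close>, a term of the exponential series for \<open>n = exp L\<close>, at least \<open>5 * L\<close>, whereas \<open>2 * c\<close> is at most \<open>3.6 * L\<close>.\<close>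
  have "L * 10 \<le> L * L"
    using L by (intro mult_left_mono) auto
  then have "5 * L + L + 1 \<le> 1 + L + L\<^sup>2 / 2"
    by (simp add: power2_eq_square)
  also have "\<dots> \<le> exp L"
    using L by (intro exp_lower_Taylor_quadratic) simp
  also have "exp L = real n"
    using n by (simp add: L_def)
  finally have "2 * (e + 3) < n"
    using c L by linarith
  moreover have "4 * n \<le> 2 ^ (e + 3)"
    using e(2) by (simp add: power_add)
  ultimately show thesis
    using that[of "e + 3"] c by (simp add: L_def)
qed

theorem theorem5:
  shows "\<exists>n0::nat. \<forall>n\<ge>n0. \<exists>G :: nat pair_pre_digraph.
    pair_graph G \<and> Digraph_Component.connected (with_proj G) \<and>
    rl_p G = n \<and> real (rl_s G) > 2 * real n - 7.2 * ln (real n)"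
proof (intro exI[of _ "nat \<lceil>exp 23 :: real\<rceil>"] allI impI)
  fix n :: nat
  assume "nat \<lceil>exp 23 :: real\<rceil> \<le> n"
  then have "exp 23 \<le> real n" by linarith
  then obtain c where c: "0 < c" "4 * n \<le> 2 ^ c" "2 * c < n" "4 * real c \<le> 7.2 * ln (real n)"
    by (rule logarithmic_exponent)
  interpret miss_graph_subdivision n c "n - 2 * c"
    using c by unfold_locales auto
  have "2 * real n - 4 * real c < real (rl_s G)"
    using rl_s_gt c(3) by linarith
  with c(4) have "2 * real n - 7.2 * ln (real n) < real (rl_s G)"
    by linarith
  then show "\<exists>G :: nat pair_pre_digraph.
    pair_graph G \<and> Digraph_Component.connected (with_proj G) \<and>
    rl_p G = n \<and> real (rl_s G) > 2 * real n - 7.2 * ln (real n)"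
    using pair_graph_G connected_G rl_p_G by blast
qed

end
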